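(* Let $K$ be a compact connected semi-simple Lie group with Lie algebra $\mathfrak{k}$, and let $E\subseteq\mathfrak{k}$ be an $\operatorname{Ad}$-invariant set such that $E\cap\mathfrak{h}_+=\operatorname{conv}\{x_1,\dots,x_n\}$. The Hofer norm polytope $$P=\operatorname{conv}\{w.x-w'.x':x,x'\in\{x_1,\dots,x_n\},\ w,w'\in\mathcal{W}\}$$ derived from $E$ has set of extreme points equal to $\mathcal{W}.y$ for some regular $y$ if there is an $x_i$, say $x_1$, such that: (1) the point $x_1-w^*.x_1\in\mathfrak{h}_+$ is regular; and (2) for all $x\in\mathfrak{h}_+$ we have $\varphi_x(x_1)\ge\varphi_x(x_j)$ for $j\in\{2,\dots,n\}$, that is, $\mathfrak{h}_+$ is contained in the normal cone of $\operatorname{conv}\{x_1,\dots,x_n\}\subseteq\mathfrak{h}$ at $x_1$.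
   Context: $\mathfrak{h}\subseteq\mathfrak{k}$ is a Cartan subalgebra, $\mathfrak{h}_+$ a closed positive Weyl chamber, $\mathcal{W}$ the Weyl group acting on $\mathfrak{h}$, $\langle\cdot,\cdot\rangle$ minus the Killing form of $\mathfrak{k}$, and $\varphi_x=\langle x,\cdot\rangle$. $w^*\in\mathcal{W}$ is the unique element with $w^*.\mathfrak{h}_+=-\mathfrak{h}_+$. The normal cone of a convex set $E'\subseteq\mathfrak{h}$ at $x\in E'$ is $N(x,E')=\{y\in\mathfrak{h}:\langle y,z-x\rangle\le 0\ \forall z\in E'\}$. A point of $\mathfrak{h}$ is regular if its centralizer in $\mathfrak{k}$ is $\mathfrak{h}$ (equivalently no root vanishes on it). *)

theory Defs
  imports "HOL-Analysis.Analysis" "HOL-Algebra.Group"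
begin

section \<open>Smooth maps and Lie groups\<close>

text \<open>\<open>C\<^sup>k\<close> maps on an open set \<open>S\<close>: \<open>f\<close> is \<open>C\<^sup>k\<^sup>+\<^sup>1\<close> iff it is differentiable and all its directional
  derivatives \<open>x \<mapsto> Df(x)v\<close> are \<open>C\<^sup>k\<close>. Only used for open \<open>S\<close>.\<close>

fun Ck_on :: "nat \<Rightarrow> 'a::euclidean_space set \<Rightarrow> ('a \<Rightarrow> 'b::real_normed_vector) \<Rightarrow> bool" where
  "Ck_on 0 S f \<longleftrightarrow> continuous_on S f"
| "Ck_on (Suc k) S f \<longleftrightarrow>
     (\<forall>x\<in>S. f differentiable (at x)) \<and> (\<forall>v. Ck_on k S (\<lambda>x. frechet_derivative f (at x) v))"

definition smooth_on :: "'a::euclidean_space set \<Rightarrow> ('a \<Rightarrow> 'b::real_normed_vector) \<Rightarrow> bool" where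
  "smooth_on S f \<longleftrightarrow> (\<forall>k. Ck_on k S f)"

text \<open>A real Lie group: the group \<open>G\<close> carries a Hausdorff second countable topology \<open>T\<close> and a smooth
  atlas \<open>A\<close>. A chart is a pair \<open>(U, \<phi>)\<close> of an open set and a homeomorphism of \<open>U\<close> onto an open subset
  of Euclidean space; \<open>\<phi>\<close> is a total function, only its values on \<open>U\<close> matter, and its inverse is
  \<open>inv_into U \<phi>\<close>. The group operations are continuous, and smooth in all charts; by continuity the
  sets on which smoothness is required are open.\<close>

locale lie_group = group G
  for G :: "('g, 'm) monoid_scheme" (structure)
    and T :: "'g topology"
    and A :: "('g set \<times> ('g \<Rightarrow> real ^ 'n)) set" +
  assumes topspace_eq: "topspace T = carrier G"
    and Hausdorff: "Hausdorff_space T"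
    and second_countable: "second_countable T"
    and chart: "\<And>U \<phi>. (U, \<phi>) \<in> A \<Longrightarrow>
      openin T U \<and> open (\<phi> ` U) \<and> homeomorphic_map (subtopology T U) (top_of_set (\<phi> ` U)) \<phi>"
    and cover: "(\<Union>(U, \<phi>)\<in>A. U) = carrier G"
    and compatible: "\<And>U \<phi> V \<psi>. (U, \<phi>) \<in> A \<Longrightarrow> (V, \<psi>) \<in> A \<Longrightarrow>
      smooth_on (\<phi> ` (U \<inter> V)) (\<lambda>a. \<psi> (inv_into U \<phi> a))"
    and mult_continuous: "continuous_map (prod_topology T T) T (\<lambda>(g, h). g \<otimes> h)"
    and inv_continuous: "continuous_map T T (\<lambda>g. inv g)"
    and mult_smooth: "\<And>U \<phi> V \<psi> W \<xi>. (U, \<phi>) \<in> A \<Longrightarrow> (V, \<psi>) \<in> A \<Longrightarrow> (W, \<xi>) \<in> A \<Longrightarrow>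
      smooth_on {(\<phi> g, \<psi> h) | g h. g \<in> U \<and> h \<in> V \<and> g \<otimes> h \<in> W}
        (\<lambda>(a, b). \<xi> (inv_into U \<phi> a \<otimes> inv_into V \<psi> b))"
    and inv_smooth: "\<And>U \<phi> V \<psi>. (U, \<phi>) \<in> A \<Longrightarrow> (V, \<psi>) \<in> A \<Longrightarrow>
      smooth_on {\<phi> g | g. g \<in> U \<and> inv g \<in> V} (\<lambda>a. \<psi> (inv (inv_into U \<phi> a)))"

text \<open>Throughout, \<open>(U, \<phi>)\<close> is a chart at the identity and the Lie algebra \<open>T\<^sub>1G\<close> is identified with
  \<open>real ^ 'n\<close> by the differential of \<open>\<phi>\<close>. \<open>Ad g\<close> is the differential at the identity of conjugation
  by \<open>g\<close>, and the Lie bracket is \<open>[x, y] = ad x y\<close> with \<open>ad\<close> the differential of \<open>Ad\<close> at the identity.\<close>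

definition Ad :: "('g, 'm) monoid_scheme \<Rightarrow> 'g set \<Rightarrow> ('g \<Rightarrow> real ^ 'n) \<Rightarrow> 'g \<Rightarrow> real ^ 'n \<Rightarrow> real ^ 'n" where
  "Ad G U \<phi> g v =
     frechet_derivative (\<lambda>a. \<phi> (g \<otimes>\<^bsub>G\<^esub> inv_into U \<phi> a \<otimes>\<^bsub>G\<^esub> inv\<^bsub>G\<^esub> g)) (at (\<phi> \<one>\<^bsub>G\<^esub>)) v"

definition lie_bracket ::
  "('g, 'm) monoid_scheme \<Rightarrow> 'g set \<Rightarrow> ('g \<Rightarrow> real ^ 'n) \<Rightarrow> real ^ 'n \<Rightarrow> real ^ 'n \<Rightarrow> real ^ 'n" where
  "lie_bracket G U \<phi> x y =
     frechet_derivative (\<lambda>a. Ad G U \<phi> (inv_into U \<phi> a) y) (at (\<phi> \<one>\<^bsub>G\<^esub>)) x"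


section \<open>Lie algebras\<close>

text \<open>\<open>br\<close> is a Lie bracket on the whole space \<open>real ^ 'n\<close>.\<close>

definition bracket_span ::
  "('a::real_vector \<Rightarrow> 'a \<Rightarrow> 'a) \<Rightarrow> 'a set \<Rightarrow> 'a set \<Rightarrow> 'a set" where
  "bracket_span br X Y = span {br x y | x y. x \<in> X \<and> y \<in> Y}"

definition lie_subalgebra :: "('a::real_vector \<Rightarrow> 'a \<Rightarrow> 'a) \<Rightarrow> 'a set \<Rightarrow> bool" where
  "lie_subalgebra br \<hh> \<longleftrightarrow> subspace \<hh> \<and> (\<forall>x\<in>\<hh>. \<forall>y\<in>\<hh>. br x y \<in> \<hh>)"

definition lie_ideal :: "('a::real_vector \<Rightarrow> 'a \<Rightarrow> 'a) \<Rightarrow> 'a set \<Rightarrow> bool" where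
  "lie_ideal br I \<longleftrightarrow> subspace I \<and> (\<forall>x. \<forall>y\<in>I. br x y \<in> I)"

definition lie_solvable :: "('a::real_vector \<Rightarrow> 'a \<Rightarrow> 'a) \<Rightarrow> 'a set \<Rightarrow> bool" where
  "lie_solvable br I \<longleftrightarrow> (\<exists>k. ((\<lambda>J. bracket_span br J J) ^^ k) I = {0})"

definition lie_nilpotent :: "('a::real_vector \<Rightarrow> 'a \<Rightarrow> 'a) \<Rightarrow> 'a set \<Rightarrow> bool" where
  "lie_nilpotent br \<hh> \<longleftrightarrow> (\<exists>k. ((\<lambda>J. bracket_span br \<hh> J) ^^ k) \<hh> = {0})"

definition lie_semisimple :: "('a::real_vector \<Rightarrow> 'a \<Rightarrow> 'a) \<Rightarrow> bool" where
  "lie_semisimple br \<longleftrightarrow> (\<forall>I. lie_ideal br I \<and> lie_solvable br I \<longrightarrow> I = {0})"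

definition lie_normalizer :: "('a::real_vector \<Rightarrow> 'a \<Rightarrow> 'a) \<Rightarrow> 'a set \<Rightarrow> 'a set" where
  "lie_normalizer br \<hh> = {x. \<forall>y\<in>\<hh>. br x y \<in> \<hh>}"

definition lie_centralizer :: "('a::real_vector \<Rightarrow> 'a \<Rightarrow> 'a) \<Rightarrow> 'a \<Rightarrow> 'a set" where
  "lie_centralizer br x = {z. br x z = 0}"

definition cartan_subalgebra :: "('a::real_vector \<Rightarrow> 'a \<Rightarrow> 'a) \<Rightarrow> 'a set \<Rightarrow> bool" where
  "cartan_subalgebra br \<hh> \<longleftrightarrow>
     lie_subalgebra br \<hh> \<and> lie_nilpotent br \<hh> \<and> lie_normalizer br \<hh> = \<hh>"

definition killing_form :: "(real ^ 'n \<Rightarrow> real ^ 'n \<Rightarrow> real ^ 'n) \<Rightarrow> real ^ 'n \<Rightarrow> real ^ 'n \<Rightarrow> real" where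
  "killing_form br x y = trace (matrix (\<lambda>z. br x (br y z)))"

text \<open>The form \<open>\<langle>x, y\<rangle>\<close>; its partial application \<open>kip br x\<close> is the functional \<open>\<phi>\<^sub>x\<close>.\<close>

definition kip :: "(real ^ 'n \<Rightarrow> real ^ 'n \<Rightarrow> real ^ 'n) \<Rightarrow> real ^ 'n \<Rightarrow> real ^ 'n \<Rightarrow> real" where
  "kip br x y = - killing_form br x y"

definition regular_point :: "('a::real_vector \<Rightarrow> 'a \<Rightarrow> 'a) \<Rightarrow> 'a set \<Rightarrow> 'a \<Rightarrow> bool" where
  "regular_point br \<hh> x \<longleftrightarrow> x \<in> \<hh> \<and> lie_centralizer br x = \<hh>"


section \<open>Roots, Weyl group, Weyl chambers\<close>

text \<open>A real root \<open>\<alpha>\<close> of a compact Lie algebra is a nonzero real functional on \<open>\<hh>\<close> such that some nonzero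
  vector \<open>u + iv\<close> of the complexification satisfies \<open>[x, u + iv] = i \<alpha>(x) (u + iv)\<close> for all \<open>x \<in> \<hh>\<close>;
  the condition below is the real and imaginary part of this equation. The root \<open>\<alpha>\<close> is represented by
  the vector \<open>t \<in> \<hh>\<close> with \<open>\<alpha>(x) = \<langle>t, x\<rangle>\<close>.\<close>

definition roots :: "(real ^ 'n \<Rightarrow> real ^ 'n \<Rightarrow> real ^ 'n) \<Rightarrow> (real ^ 'n) set \<Rightarrow> (real ^ 'n) set" where
  "roots br \<hh> = {t \<in> \<hh>. t \<noteq> 0 \<and> (\<exists>u v. (u, v) \<noteq> (0, 0) \<and>
     (\<forall>x\<in>\<hh>. br x u = - (kip br t x *\<^sub>R v) \<and> br x v = kip br t x *\<^sub>R u))}"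

definition root_reflection ::
  "(real ^ 'n \<Rightarrow> real ^ 'n \<Rightarrow> real ^ 'n) \<Rightarrow> real ^ 'n \<Rightarrow> real ^ 'n \<Rightarrow> real ^ 'n" where
  "root_reflection br t x = x - (2 * kip br t x / kip br t t) *\<^sub>R t"

text \<open>The Weyl group is generated by the reflections of \<open>\<hh>\<close> in the root hyperplanes. Its elements are
  represented by functions on the whole Lie algebra, acting trivially on the orthogonal complement of
  \<open>\<hh>\<close>, so each element has exactly one representative. Since the generators are involutions, closure
  under composition gives the group.\<close>

inductive_set weyl_group ::
  "(real ^ 'n \<Rightarrow> real ^ 'n \<Rightarrow> real ^ 'n) \<Rightarrow> (real ^ 'n) set \<Rightarrow> (real ^ 'n \<Rightarrow> real ^ 'n) set"
  for br :: "real ^ 'n \<Rightarrow> real ^ 'n \<Rightarrow> real ^ 'n" and \<hh> :: "(real ^ 'n) set" where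
  id: "id \<in> weyl_group br \<hh>"
| reflection: "t \<in> roots br \<hh> \<Longrightarrow> w \<in> weyl_group br \<hh> \<Longrightarrow> root_reflection br t \<circ> w \<in> weyl_group br \<hh>"

definition closed_weyl_chamber ::
  "(real ^ 'n \<Rightarrow> real ^ 'n \<Rightarrow> real ^ 'n) \<Rightarrow> (real ^ 'n) set \<Rightarrow> (real ^ 'n) set \<Rightarrow> bool" where
  "closed_weyl_chamber br \<hh> H \<longleftrightarrow>
     (\<exists>C \<in> components {x \<in> \<hh>. \<forall>t\<in>roots br \<hh>. kip br t x \<noteq> 0}. H = closure C)"


section \<open>The Hofer norm polytope\<close>

definition hofer_polytope :: "('a::real_vector \<Rightarrow> 'a) set \<Rightarrow> 'a set \<Rightarrow> 'a set" where
  "hofer_polytope W X = convex hull {w x - w' x' | w w' x x'. w \<in> W \<and> w' \<in> W \<and> x \<in> X \<and> x' \<in> X}"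

end

theory Submission
  imports Defs
begin

text \<open>
  Put \<open>y = x\<^sub>1 - w\<^sup>*.x\<^sub>1\<close>. On the chamber, the support function of \<open>P\<close> is \<open>\<langle>\<cdot>, y\<rangle>\<close>: for
  dominant \<open>z\<close> and \<open>x\<close> one has \<open>\<langle>z, w.x\<rangle> \<le> \<langle>z, x\<rangle>\<close>, the point \<open>x\<^sub>1\<close> maximises \<open>\<langle>z, \<cdot>\<rangle>\<close> among the
  \<open>x\<^sub>j\<close>, and \<open>-w\<^sup>*\<close> preserves the chamber. As every point of the Cartan subalgebra is conjugate to a
  dominant one, \<open>P\<close> is the convex hull of the orbit of \<open>y\<close>, and all points of an orbit are extreme
  because they have the same norm.

  The facts on the Weyl group come from two sources. A fixed point of the compact group gives an
  \<open>Ad\<close>-invariant inner product, whence the Killing form is negative definite, and \<open>exp (ad u)\<close> for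
  a suitable root vector \<open>u\<close> induces a given root reflection, so the roots form a finite
  reflection-invariant set. The rest is the theory of finite reflection groups, through simple roots
  and the deletion condition.
\<close>

section \<open>Finite reflection groups\<close>

text \<open>The bracket is given only by derivatives in a chart, so the Lie algebra axioms have to
  be derived. Antisymmetry comes from the symmetry of the second derivative of the multiplication;
  the Jacobi identity and the skewness of \<open>ad\<close> come from differentiating the
  compatibility of \<open>Ad\<close> with the bracket and with an invariant form. Before that,
  differentiability of \<open>Ad\<close> has to be extracted from a linear system, because
  smoothness is given for the group operations alone. Two inner products occur. \<open>B\<close>,
  the fixed point, makes each \<open>ad x\<close> skew and thereby shows that \<open>kip\<close> is
  positive definite; the reflection groups then live in the geometry of \<open>kip\<close>. Neither
  has to be the inner product of \<open>real^'n\<close>, so the theory is developed for an arbitrary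
  form \<open>q\<close>. The inequality <z, w x> \<le> <z, x> on the chamber is proved by induction
  on the length of a word in simple reflections, which is why every element must first be shown to
  be such a word.\<close>

locale inner_form =
  fixes q :: "'a::euclidean_space \<Rightarrow> 'a \<Rightarrow> real"
  assumes bilin: "bilinear q"
    and sym: "q x y = q y x"
    and pos: "x \<noteq> 0 \<Longrightarrow> q x x > 0"
begin

lemma lin_left: "linear (\<lambda>x. q x y)" and lin_right: "linear (q x)"
  using bilin by (auto simp: bilinear_def)

lemmas q_simps =
  linear_add[OF lin_left] linear_add[OF lin_right] linear_diff[OF lin_left] linear_diff[OF lin_right]
  linear_scale[OF lin_left] linear_scale[OF lin_right] linear_neg[OF lin_left] linear_neg[OF lin_right]
  linear_0[OF lin_left] linear_0[OF lin_right] linear_sum[OF lin_left] linear_sum[OF lin_right]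

lemma nonneg: "q x x \<ge> 0"
  using pos[of x] by (cases "x = 0") (auto simp: q_simps)

lemma eq_zero_iff: "q x x = 0 \<longleftrightarrow> x = 0"
  using pos[of x] by (cases "x = 0") (auto simp: q_simps)

section \<open>Orthonormal bases and representation of functionals\<close>

definition orthonormal :: "'a set \<Rightarrow> bool" where
  "orthonormal X \<longleftrightarrow> (\<forall>a\<in>X. \<forall>b\<in>X. q a b = (if a = b then 1 else 0))"

text \<open>It bounds orthonormal sets here and later makes the set of root vectors finite.\<close>

lemma orthogonal_independent:
  assumes "0 \<notin> X" and orth: "\<And>a b. a \<in> X \<Longrightarrow> b \<in> X \<Longrightarrow> a \<noteq> b \<Longrightarrow> q a b = 0"
  shows "independent X"
proof
  assume "dependent X"
  then obtain S u where S: "finite S" "S \<subseteq> X" "(\<Sum>v\<in>S. u v *\<^sub>R v) = 0" and "\<exists>v\<in>S. u v \<noteq> 0"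
    unfolding dependent_explicit by auto
  then obtain v where v: "v \<in> S" "u v \<noteq> 0" by auto
  have "0 = q (\<Sum>b\<in>S. u b *\<^sub>R b) v" using S by (simp add: q_simps)
  also have "\<dots> = (\<Sum>b\<in>S. u b * q b v)" by (simp add: q_simps)
  also have "\<dots> = (\<Sum>b\<in>S. if b = v then u v * q v v else 0)"
  proof (intro sum.cong refl)
    fix b assume "b \<in> S"
    then show "u b * q b v = (if b = v then u v * q v v else 0)"
      using orth[of b v] S v by auto
  qed
  also have "\<dots> = u v * q v v" using S v by simp
  finally show False using v pos[of v] S assms(1) by auto
qed

text \<open>An orthonormal subset of \<open>S\<close> of maximal size does it: if some
  \<open>v\<close> differed from its expansion, the normalised remainder could be added. A maximal
  size exists because orthonormal sets are independent.\<close>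

lemma orthonormal_basis_exists:
  assumes "subspace S"
  obtains X where "finite X" "X \<subseteq> S" "orthonormal X" "\<And>v. v \<in> S \<Longrightarrow> v = (\<Sum>b\<in>X. q v b *\<^sub>R b)"
proof -
  let ?P = "\<lambda>X. X \<subseteq> S \<and> orthonormal X"
  have bound: "finite X \<and> card X \<le> DIM('a)" if "?P X" for X
  proof (rule independent_bound, rule orthogonal_independent)
    show "0 \<notin> X"
    proof
      assume "0 \<in> X"
      then have "q 0 0 = 1" using that by (auto simp: orthonormal_def)
      then show False by (simp add: q_simps)
    qed
  qed (use that in \<open>auto simp: orthonormal_def\<close>)
  obtain X where X: "?P X" and max: "\<And>Y. ?P Y \<Longrightarrow> card Y \<le> card X"
  proof -
    have "?P {}" by (auto simp: orthonormal_def)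
    moreover have "\<forall>Y. ?P Y \<longrightarrow> card Y < Suc (DIM('a))" using bound by (auto simp: less_Suc_eq_le)
    ultimately show ?thesis using that ex_has_greatest_nat[of ?P "{}" card "Suc (DIM('a))"] by blast
  qed
  have fin: "finite X" using bound X by auto
  have "v = (\<Sum>b\<in>X. q v b *\<^sub>R b)" if v: "v \<in> S" for v
  proof (rule ccontr)
    define r where "r = v - (\<Sum>b\<in>X. q v b *\<^sub>R b)"
    assume "v \<noteq> (\<Sum>b\<in>X. q v b *\<^sub>R b)"
    then have r0: "r \<noteq> 0" by (auto simp: r_def)
    have rS: "r \<in> S" unfolding r_def using X v assms
      by (intro subspace_diff subspace_sum subspace_scale) auto
    have rb: "q r b = 0" if b: "b \<in> X" for b
    proof -
      have "(\<Sum>a\<in>X. q v a * q a b) = (\<Sum>a\<in>X. if a = b then q v b else 0)"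
        using X b by (intro sum.cong) (auto simp: orthonormal_def)
      then show ?thesis using fin b by (simp add: r_def q_simps)
    qed
    define e where "e = (1 / sqrt (q r r)) *\<^sub>R r"
    have ee: "q e e = 1" using pos[OF r0] by (simp add: e_def q_simps)
    have eb: "q e b = 0" "q b e = 0" if "b \<in> X" for b using rb[OF that] sym[of b e] by (simp_all add: e_def q_simps)
    have "e \<notin> X" using eb(1) ee by force
    have "?P (insert e X)"
      using X ee eb rS assms by (auto simp: orthonormal_def e_def subspace_scale)
    from max[OF this] show False using fin \<open>e \<notin> X\<close> by simp
  qed
  then show ?thesis using that[of X] fin X by blast
qed

text \<open>It will replace a separating functional, which comes from the Euclidean inner product,
  by the pairing with a vector of \<open>S\<close> under \<open>q\<close>.\<close>

lemma riesz:
  assumes "subspace S" "linear f"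
  obtains z where "z \<in> S" "\<And>v. v \<in> S \<Longrightarrow> f v = q z v"
proof -
  obtain X where X: "finite X" "X \<subseteq> S" "\<And>v. v \<in> S \<Longrightarrow> v = (\<Sum>b\<in>X. q v b *\<^sub>R b)"
    using orthonormal_basis_exists[OF assms(1)] by metis
  show ?thesis
  proof
    show "(\<Sum>b\<in>X. f b *\<^sub>R b) \<in> S" using X assms(1)
      by (intro subspace_sum subspace_scale) auto
    fix v assume "v \<in> S"
    have "f v = f (\<Sum>b\<in>X. q v b *\<^sub>R b)" using X(3)[OF \<open>v \<in> S\<close>] by simp
    also have "\<dots> = (\<Sum>b\<in>X. f b * q b v)"
      by (simp add: linear_sum[OF assms(2)] linear_scale[OF assms(2)] sym[of v] mult.commute)
    finally show "f v = q (\<Sum>b\<in>X. f b *\<^sub>R b) v" by (simp add: q_simps)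
  qed
qed

text \<open>For \<open>t = 0\<close> the quotient is 0 and the map is the identity, so isometry and
  involution hold for every \<open>t\<close>.\<close>

definition refl :: "'a \<Rightarrow> 'a \<Rightarrow> 'a" where
  "refl t x = x - (2 * q t x / q t t) *\<^sub>R t"

lemma linear_refl: "linear (refl t)"
  by (rule linearI) (simp_all add: refl_def q_simps algebra_simps add_divide_distrib)

lemma refl_orthogonal: "q (refl t x) (refl t y) = q x y"
  by (cases "q t t = 0") (simp_all add: refl_def q_simps field_simps sym[of x t] sym[of y t])

lemma refl_self: "t \<noteq> 0 \<Longrightarrow> refl t t = - t"
  using pos[of t] by (simp add: refl_def scaleR_2)

lemma refl_refl: "refl t (refl t x) = x"
  using pos[of t] by (cases "t = 0") (simp_all add: refl_def q_simps)

lemma refl_scale: "k \<noteq> 0 \<Longrightarrow> refl (k *\<^sub>R t) = refl t"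
  by (auto simp: refl_def q_simps fun_eq_iff)

text \<open>Elements are kept as words because the length of a word drives the later inductions. The
  last letter acts first.\<close>

definition word :: "'a list \<Rightarrow> 'a \<Rightarrow> 'a" where
  "word ts = foldr (\<lambda>t. (\<circ>) (refl t)) ts id"

lemma word_simps [simp]: "word [] = id" "word (t # ts) = refl t \<circ> word ts"
  by (simp_all add: word_def)

lemma word_append: "word (ts @ us) = word ts \<circ> word us"
  by (induction ts) (auto simp: comp_assoc)

lemma linear_word: "linear (word ts)"
proof (induction ts)
  case Nil
  show ?case by (simp add: id_def linear_ident)
next
  case (Cons t ts)
  show ?case unfolding word_simps by (rule linear_compose[OF Cons linear_refl])
qed

lemma word_orthogonal: "q (word ts x) (word ts y) = q x y"
  by (induction ts) (auto simp: refl_orthogonal)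

lemma word_rev: "word (rev ts) (word ts x) = x"
  by (induction ts arbitrary: x) (auto simp: word_append refl_refl)

lemma word_rev': "word ts (word (rev ts) x) = x"
  using word_rev[of "rev ts"] by simp

text \<open>The rule w s_t w^-1 = s_(w t), a consequence of orthogonality. It lets a reflection pass
  through a word in \<open>deletion\<close>.\<close>

lemma word_refl: "word ts (refl t x) = refl (word ts t) (word ts x)"
  by (simp add: refl_def linear_diff[OF linear_word] linear_scale[OF linear_word] word_orthogonal)

end

section \<open>Groups generated by the reflections in a finite stable set\<close>

locale finite_reflections = inner_form +
  fixes H R :: "'a set"
  assumes subspace_H: "subspace H"
    and finite_R: "finite R" and R_H: "R \<subseteq> H" and zero_R: "0 \<notin> R"
    and refl_R: "t \<in> R \<Longrightarrow> r \<in> R \<Longrightarrow> refl t r \<in> R"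
begin

definition W :: "('a \<Rightarrow> 'a) set" where "W = word ` lists R"

lemma word_R: "set ts \<subseteq> R \<Longrightarrow> r \<in> R \<Longrightarrow> word ts r \<in> R"
  by (induction ts) (auto simp: refl_R)

lemma refl_H: "t \<in> R \<Longrightarrow> x \<in> H \<Longrightarrow> refl t x \<in> H"
  unfolding refl_def using R_H subspace_H by (intro subspace_diff subspace_scale) auto

lemma word_H: "set ts \<subseteq> R \<Longrightarrow> x \<in> H \<Longrightarrow> word ts x \<in> H"
  by (induction ts) (auto simp: refl_H)

lemma uminus_R: "t \<in> R \<Longrightarrow> - t \<in> R"
  using refl_R[of t t] refl_self[of t] zero_R by force

lemma word_span: "set ts \<subseteq> R \<Longrightarrow> word ts x - x \<in> span R"
proof (induction ts)
  case (Cons t ts)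
  have "refl t (word ts x) - x = (word ts x - x) - (2 * q t (word ts x) / q t t) *\<^sub>R t"
    by (simp add: refl_def)
  moreover have "(word ts x - x) - (2 * q t (word ts x) / q t t) *\<^sub>R t \<in> span R"
    by (rule span_diff) (use Cons in \<open>auto intro: span_scale span_base\<close>)
  ultimately show ?case by (simp only: word_simps comp_apply)
qed (auto simp: span_zero)

text \<open>Words move \<open>x\<close> only within \<open>span R\<close>, so the difference
  \<open>d\<close> and its preimage \<open>e\<close> under \<open>word ts\<close> lie there. Both
  words agree at \<open>e\<close>, hence <d, d> = <x, e> - <x, e> = 0. Consequently restriction to
  \<open>R\<close> embeds \<open>W\<close> in a finite set of maps.\<close>

lemma word_eqI:
  assumes "set ts \<subseteq> R" "set us \<subseteq> R" and eq: "\<And>r. r \<in> R \<Longrightarrow> word ts r = word us r"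
  shows "word ts = word us"
proof
  fix x
  have eq_span: "word ts r = word us r" if "r \<in> span R" for r
    using linear_eq_on_span[OF linear_word linear_word eq that] .
  define d where "d = word ts x - word us x"
  have "d = (word ts x - x) - (word us x - x)" by (simp add: d_def)
  then have d: "d \<in> span R" using word_span assms span_diff by metis
  define e where "e = word (rev ts) d"
  have "e = (e - d) + d" by simp
  moreover have "e - d \<in> span R" using word_span[of "rev ts" d] assms by (simp add: e_def)
  ultimately have e: "e \<in> span R" using span_add[OF _ d] by metis
  have de: "d = word ts e" by (simp add: e_def word_rev')
  have "q d d = q (word ts x) (word ts e) - q (word us x) (word us e)"
  proof -
    have "q d (word ts e) = q (word ts x) (word ts e) - q (word us x) (word ts e)"
      by (simp add: d_def q_simps)
    then show ?thesis using eq_span[OF e] de by simp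
  qed
  then have "q d d = 0" by (simp add: word_orthogonal)
  then show "word ts x = word us x" by (simp add: eq_zero_iff d_def)
qed

lemma finite_W: "finite W"
proof (rule inj_on_finite[of "\<lambda>w. restrict w R" _ "PiE R (\<lambda>_. R)"])
  show "inj_on (\<lambda>w. restrict w R) W"
  proof (rule inj_onI)
    fix v w assume "v \<in> W" "w \<in> W" and eq: "restrict v R = restrict w R"
    then obtain ts us where *: "set ts \<subseteq> R" "v = word ts" "set us \<subseteq> R" "w = word us"
      by (auto simp: W_def)
    have "v r = w r" if "r \<in> R" for r using fun_cong[OF eq, of r] that by simp
    then show "v = w" using word_eqI[of ts us] * by auto
  qed
  show "(\<lambda>w. restrict w R) ` W \<subseteq> PiE R (\<lambda>_. R)"
    using word_R by (force simp: W_def lists_eq_set)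
  show "finite (PiE R (\<lambda>_. R))" using finite_R by (intro finite_PiE) auto
qed

section \<open>Positive roots, simple roots and the deletion condition\<close>

definition cone_over :: "'a set \<Rightarrow> 'a set" where
  "cone_over D = {v. \<exists>b. (\<forall>d\<in>D. b d \<ge> 0) \<and> v = (\<Sum>d\<in>D. b d *\<^sub>R d)}"

definition positive_roots :: "'a \<Rightarrow> 'a set" where
  "positive_roots c = {t \<in> R. q t c > 0}"

text \<open>The property that deletion uses is taken as definition, instead of indecomposability.
  The exception covers all multiples of \<open>d\<close>, since \<open>R\<close> may contain several
  and \<open>refl d\<close> makes the positive ones negative.\<close>

definition simple :: "'a \<Rightarrow> 'a \<Rightarrow> bool" where
  "simple c d \<longleftrightarrow> d \<in> positive_roots c \<and>
     (\<forall>r\<in>positive_roots c. (\<exists>k. r = k *\<^sub>R d) \<or> refl d r \<in> positive_roots c)"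

definition chamber :: "'a \<Rightarrow> 'a set" where
  "chamber c = {x \<in> H. \<forall>t\<in>positive_roots c. q t x \<ge> 0}"

context
  fixes c assumes regular: "\<And>t. t \<in> R \<Longrightarrow> q t c \<noteq> 0"
begin

lemma uminus_positive: "t \<in> R \<Longrightarrow> t \<notin> positive_roots c \<Longrightarrow> - t \<in> positive_roots c"
  using regular[of t] by (auto simp: positive_roots_def uminus_R q_simps)

text \<open>The simple roots are a minimal set spanning the cone of positive roots: if \<open>s\<^sub>t\<close> made a
  positive \<open>r\<close> negative, then a positive multiple of \<open>t\<close> would be a sum of two positive
  roots, and \<open>t\<close> would be redundant.\<close>

lemma simple_roots_exist:
  obtains D where "finite D" "\<And>d. d \<in> D \<Longrightarrow> simple c d" "positive_roots c \<subseteq> cone_over D"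
proof -
  let ?P = "\<lambda>D. D \<subseteq> positive_roots c \<and> positive_roots c \<subseteq> cone_over D"
  have fin: "finite D" if "?P D" for D
    using that finite_R by (auto simp: positive_roots_def intro: finite_subset)
  have "?P (positive_roots c)"
  proof (clarsimp simp: cone_over_def)
    fix v assume v: "v \<in> positive_roots c"
    have "finite (positive_roots c)" using finite_R by (auto simp: positive_roots_def)
    then have "(\<Sum>d\<in>positive_roots c. (if d = v then 1 else 0) *\<^sub>R d) = v"
      using v by (simp add: if_distrib[of "\<lambda>a. a *\<^sub>R _"] cong: if_cong)
    then show "\<exists>b. (\<forall>d\<in>positive_roots c. 0 \<le> b d) \<and> v = (\<Sum>d\<in>positive_roots c. b d *\<^sub>R d)"
      by (intro exI[of _ "\<lambda>d. if d = v then 1 else 0"]) auto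
  qed
  then obtain D where D: "?P D" and min: "\<And>D'. ?P D' \<Longrightarrow> card D \<le> card D'"
    using ex_has_least_nat[of ?P "positive_roots c" card] by blast
  have finD: "finite D" using fin D by blast
  have "simple c t" if t: "t \<in> D" for t
    unfolding simple_def
  proof (intro conjI ballI disjCI)
    show tp: "t \<in> positive_roots c" using t D by auto
    then have tR: "t \<in> R" "q t c > 0" by (auto simp: positive_roots_def)
    fix r assume r: "r \<in> positive_roots c" and neg: "refl t r \<notin> positive_roots c"
    have rR: "r \<in> R" "q r c > 0" using r by (auto simp: positive_roots_def)
    define s where "s = - refl t r"
    define a where "a = 2 * q t r / q t t"
    have s: "s \<in> positive_roots c" unfolding s_def using neg rR tR refl_R uminus_positive by blast
    have at: "a *\<^sub>R t = r + s" by (simp add: s_def a_def refl_def)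
    obtain b where b: "\<And>d. d \<in> D \<Longrightarrow> b d \<ge> 0" "r = (\<Sum>d\<in>D. b d *\<^sub>R d)"
      using subsetD[OF conjunct2[OF D] r] unfolding cone_over_def by blast
    obtain b' where b': "\<And>d. d \<in> D \<Longrightarrow> b' d \<ge> 0" "s = (\<Sum>d\<in>D. b' d *\<^sub>R d)"
      using subsetD[OF conjunct2[OF D] s] unfolding cone_over_def by blast
    define m where "m d = b d + b' d" for d
    have m0: "m d \<ge> 0" "b d \<ge> 0" "b' d \<ge> 0" if "d \<in> D" for d using b b' that by (auto simp: m_def)
    have "a *\<^sub>R t = (\<Sum>d\<in>D. m d *\<^sub>R d)"
      by (simp add: at b(2) b'(2) m_def scaleR_add_left sum.distrib)
    also have "\<dots> = m t *\<^sub>R t + (\<Sum>d\<in>D-{t}. m d *\<^sub>R d)" using finD t by (simp add: sum.remove)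
    finally have key: "(a - m t) *\<^sub>R t = (\<Sum>d\<in>D-{t}. m d *\<^sub>R d)" by (simp add: algebra_simps)
    show "\<exists>k. r = k *\<^sub>R t"
    proof (cases "a - m t > 0")
      case True
      define n where "n d = m d / (a - m t)" for d
      have "t = (1 / (a - m t)) *\<^sub>R ((a - m t) *\<^sub>R t)" using True by simp
      also have "\<dots> = (\<Sum>d\<in>D-{t}. n d *\<^sub>R d)" unfolding key by (simp add: scaleR_sum_right n_def)
      finally have tn: "t = (\<Sum>d\<in>D-{t}. n d *\<^sub>R d)" .
      have n0: "n d \<ge> 0" if "d \<in> D" for d using m0 that True by (auto simp: n_def)
      have "?P (D - {t})"
      proof (intro conjI subsetI)
        fix v assume "v \<in> positive_roots c"
        then obtain e where e: "\<And>d. d \<in> D \<Longrightarrow> e d \<ge> 0" "v = (\<Sum>d\<in>D. e d *\<^sub>R d)"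
          using D unfolding cone_over_def by blast
        have "v = e t *\<^sub>R t + (\<Sum>d\<in>D-{t}. e d *\<^sub>R d)" using e finD t by (simp add: sum.remove)
        also have "e t *\<^sub>R t = (\<Sum>d\<in>D-{t}. (e t * n d) *\<^sub>R d)"
          using arg_cong[OF tn, of "\<lambda>v. e t *\<^sub>R v"] by (simp add: scaleR_sum_right)
        finally have "v = (\<Sum>d\<in>D-{t}. (e t * n d + e d) *\<^sub>R d)"
          by (simp add: scaleR_add_left sum.distrib)
        then show "v \<in> cone_over (D - {t})"
          unfolding cone_over_def using e n0 t by (auto intro!: exI[of _ "\<lambda>d. e t * n d + e d"])
      qed (use D in auto)
      from min[OF this] show ?thesis using card_Diff1_less[OF finD t] by linarith
    next
      \<comment> \<open>Pairing \<open>key\<close> with \<open>c\<close> gives a sum of nonnegative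
        terms on one side and a nonpositive number on the other. So all coefficients off
        \<open>t\<close> vanish, and \<open>r\<close> falls under the exception in
        \<open>simple\<close>.\<close>
      case False
      have "(\<Sum>d\<in>D-{t}. m d * q d c) = (a - m t) * q t c"
        using arg_cong[OF key, of "\<lambda>v. q v c"] by (simp add: q_simps)
      also have "\<dots> \<le> 0" using False tR by (auto simp: mult_nonpos_nonneg)
      finally have le: "(\<Sum>d\<in>D-{t}. m d * q d c) \<le> 0" .
      have dc: "q d c > 0" if "d \<in> D" for d using D that by (auto simp: positive_roots_def)
      have nn: "m d * q d c \<ge> 0" if "d \<in> D - {t}" for d
        using m0[of d] dc[of d] that by (intro mult_nonneg_nonneg) auto
      have "(\<Sum>d\<in>D-{t}. m d * q d c) = 0"
        by (rule antisym[OF le sum_nonneg[OF nn]])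
      then have "\<forall>d\<in>D-{t}. m d * q d c = 0" using nn finD
        by (subst sum_nonneg_eq_0_iff[symmetric]) auto
      then have "b d = 0" if "d \<in> D - {t}" for d using that dc[of d] m0[of d] by (force simp: m_def)
      then have "r = b t *\<^sub>R t" using b(2) finD t by (simp add: sum.remove)
      then show ?thesis by blast
    qed
  qed
  then show ?thesis using that finD D by blast
qed

lemma simple_R: "simple c d \<Longrightarrow> d \<in> R"
  by (auto simp: simple_def positive_roots_def)

text \<open>Read from the right, the word turns \<open>t\<close> negative at some letter
  \<open>d\<close>. Just before it the image of \<open>t\<close> is a multiple of \<open>d\<close>,
  since \<open>d\<close> is simple; by conjugation \<open>refl t\<close> then becomes
  \<open>refl d\<close> in front of the remaining letters and cancels that letter.\<close>

lemma deletion: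
  assumes "list_all (simple c) ds" "t \<in> positive_roots c" "word ds t \<notin> positive_roots c"
  shows "\<exists>es. list_all (simple c) es \<and> length es < length ds \<and> word ds \<circ> refl t = word es"
  using assms
proof (induction ds)
  case (Cons d ds)
  show ?case
  proof (cases "word ds t \<in> positive_roots c")
    case False
    then obtain es where "list_all (simple c) es" "length es < length ds" "word ds \<circ> refl t = word es"
      using Cons.IH Cons.prems by (auto simp del: comp_apply)
    moreover from this(3) have "word (d # ds) \<circ> refl t = word (d # es)"
      by (metis comp_assoc word_simps(2))
    ultimately show ?thesis using Cons.prems by (intro exI[of _ "d # es"]) (simp del: word_simps)
  next
    case True
    then obtain k where k: "word ds t = k *\<^sub>R d"
      using Cons.prems by (auto simp: simple_def)
    have "k \<noteq> 0" using True zero_R k by (auto simp: positive_roots_def)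
    have "word ds (refl t x) = refl d (word ds x)" for x
      by (simp add: word_refl k refl_scale \<open>k \<noteq> 0\<close>)
    then have "word (d # ds) \<circ> refl t = word ds" by (auto simp: fun_eq_iff refl_refl)
    then show ?thesis using Cons.prems by (intro exI[of _ ds]) (simp del: word_simps)
  qed
qed auto

text \<open>With a simple word \<open>ds\<close> for the longest element, deletion applies to every
  positive root: \<open>word ds \<circ> refl t\<close> is a simple word, and cancelling
  \<open>word ds\<close> by its reversal leaves \<open>refl t\<close>. The longest element is found
  as the minimiser of <c, v c> over the simple words, which have finitely many values.\<close>

lemma word_simple_words:
  assumes "set ts \<subseteq> R"
  shows "\<exists>ds. list_all (simple c) ds \<and> word ts = word ds"
proof -
  obtain D where D: "finite D" "\<And>d. d \<in> D \<Longrightarrow> simple c d" "positive_roots c \<subseteq> cone_over D"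
    using simple_roots_exist by metis
  have simple_word_W: "word ds \<in> W" if "list_all (simple c) ds" for ds
    using that simple_R by (auto simp: W_def list_all_iff)
  define V where "V = word ` {ds. list_all (simple c) ds}"
  have "finite V" using simple_word_W finite_subset[OF _ finite_W, of V] by (auto simp: V_def)
  moreover have "V \<noteq> {}" by (auto simp: V_def intro: exI[of _ "[]"])
  ultimately obtain v where "v \<in> V" and min: "\<And>w. w \<in> V \<Longrightarrow> q c (v c) \<le> q c (w c)"
    using arg_min_if_finite[of V "\<lambda>v. q c (v c)"] by (metis not_le)
  then obtain ds where ds: "list_all (simple c) ds" "v = word ds" by (auto simp: V_def)
  \<comment> \<open>\<open>word ds\<close> is the longest element: it makes every positive root negative.\<close>
  have le0: "q c (word ds d) \<le> 0" if "d \<in> D" for d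
  proof -
    have "simple c d" using D that by blast
    then have dc: "q d c > 0" "d \<noteq> 0" using zero_R by (auto simp: simple_def positive_roots_def)
    have "word (ds @ [d]) \<in> V" using ds \<open>simple c d\<close> by (auto simp: V_def)
    from min[OF this] have "q c (word ds c) \<le> q c (word ds (refl d c))" by (simp add: word_append ds)
    then have "(2 * q d c / q d d) * q c (word ds d) \<le> 0"
      by (simp add: refl_def linear_diff[OF linear_word] linear_scale[OF linear_word] q_simps)
    moreover have "2 * q d c / q d d > 0" using dc pos[of d] by simp
    ultimately show ?thesis by (metis mult_le_0_iff not_le)
  qed
  have neg: "word ds t \<notin> positive_roots c" if t: "t \<in> positive_roots c" for t
  proof -
    obtain b where b: "\<And>d. d \<in> D \<Longrightarrow> b d \<ge> 0" "t = (\<Sum>d\<in>D. b d *\<^sub>R d)"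
      using subsetD[OF D(3) t] unfolding cone_over_def by blast
    have "q c (word ds t) = (\<Sum>d\<in>D. b d * q c (word ds d))"
      by (simp add: b(2) linear_sum[OF linear_word] linear_scale[OF linear_word] q_simps)
    also have "\<dots> \<le> 0" using b le0 by (intro sum_nonpos) (auto simp: mult_nonneg_nonpos)
    finally show ?thesis using sym[of c] by (simp add: positive_roots_def)
  qed
  have refl_word: "\<exists>es. list_all (simple c) es \<and> refl t = word es" if t: "t \<in> positive_roots c" for t
  proof -
    obtain es where es: "list_all (simple c) es" "word ds \<circ> refl t = word es"
      using deletion[OF ds(1) t neg[OF t]] by blast
    have "refl t = word (rev ds @ es)"
      by (simp add: fun_eq_iff word_append word_rev flip: es(2))
    then show ?thesis using es ds by (intro exI[of _ "rev ds @ es"]) auto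
  qed
  have refl_word': "\<exists>es. list_all (simple c) es \<and> refl t = word es" if t: "t \<in> R" for t
  proof (cases "t \<in> positive_roots c")
    case False
    have "refl (- t) = refl t" using refl_scale[of "-1" t] by simp
    then show ?thesis using refl_word[OF uminus_positive[OF t False]] by simp
  qed (rule refl_word)
  show ?thesis using assms
  proof (induction ts)
    case (Cons t ts)
    then obtain ds where "list_all (simple c) ds" "word ts = word ds" by auto
    moreover obtain es where "list_all (simple c) es" "refl t = word es"
      using refl_word'[of t] Cons.prems by auto
    ultimately show ?case by (intro exI[of _ "es @ ds"]) (simp add: word_append)
  qed (auto intro: exI[of _ "[]"])
qed

text \<open>Split off the last letter \<open>d\<close>. If the rest \<open>es\<close> keeps
  \<open>d\<close> positive, then \<open>refl d\<close> subtracts from \<open>x\<close> a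
  nonnegative multiple of \<open>d\<close>, whose image pairs nonnegatively with \<open>z\<close>,
  so the value does not grow. Otherwise deletion gives a shorter word for the same element.\<close>

lemma simple_word_chamber_le:
  assumes "list_all (simple c) ds" "x \<in> chamber c" "z \<in> chamber c"
  shows "q z (word ds x) \<le> q z x"
  using assms(1)
proof (induction "length ds" arbitrary: ds rule: less_induct)
  case less
  show ?case
  proof (cases ds rule: rev_cases)
    case (snoc es d)
    have d: "simple c d" and es: "list_all (simple c) es" using less.prems snoc by auto
    have dp: "d \<in> positive_roots c" using d by (simp add: simple_def)
    show ?thesis
    proof (cases "word es d \<in> positive_roots c")
      case True
      have "q z (word ds x) = q z (word es x) - (2 * q d x / q d d) * q z (word es d)"
        by (simp add: snoc word_append refl_def linear_diff[OF linear_word] linear_scale[OF linear_word] q_simps)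
      moreover have "2 * q d x / q d d \<ge> 0"
        using dp assms(2) by (auto simp: chamber_def nonneg)
      moreover have "q z (word es d) \<ge> 0" using True assms(3) sym by (auto simp: chamber_def)
      moreover have "q z (word es x) \<le> q z x" using less.hyps[of es] es snoc by simp
      ultimately show ?thesis by (smt (verit) mult_nonneg_nonneg)
    next
      case False
      obtain fs where "list_all (simple c) fs" "length fs < length es" "word es \<circ> refl d = word fs"
        using deletion[OF es dp False] by blast
      moreover have "word ds = word es \<circ> refl d" by (simp add: snoc word_append)
      ultimately show ?thesis using less.hyps[of fs] snoc by simp
    qed
  qed simp
qed

lemma W_chamber_le:
  assumes "w \<in> W" "x \<in> chamber c" "z \<in> chamber c"
  shows "q z (w x) \<le> q z x"
proof -
  obtain ts where "set ts \<subseteq> R" "w = word ts" using assms(1) by (auto simp: W_def)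
  then show ?thesis using word_simple_words[of ts] simple_word_chamber_le[OF _ assms(2,3)] by metis
qed

text \<open>Maximise <c, w z> over the finite group: a positive root \<open>t\<close> with <t, w z>
  < 0 would let \<open>refl t \<circ> w\<close> do better.\<close>

lemma W_into_chamber:
  assumes "z \<in> H"
  obtains w where "w \<in> W" "w z \<in> chamber c"
proof -
  have "W \<noteq> {}" by (auto simp: W_def)
  then obtain w where w: "w \<in> W" and max: "\<And>v. v \<in> W \<Longrightarrow> q c (v z) \<le> q c (w z)"
    using arg_min_if_finite[OF finite_W, of "\<lambda>v. - q c (v z)"] by (metis neg_less_iff_less not_le)
  obtain ts where ts: "set ts \<subseteq> R" "w = word ts" using w by (auto simp: W_def)
  have "q t (w z) \<ge> 0" if t: "t \<in> positive_roots c" for t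
  proof -
    have tc: "t \<in> R" "q t c > 0" "t \<noteq> 0" using t zero_R by (auto simp: positive_roots_def)
    then have "word (t # ts) \<in> W" using ts unfolding W_def by (intro imageI) auto
    from max[OF this] have "(2 * q t (w z) / q t t) * q c t \<ge> 0" by (simp add: ts refl_def q_simps)
    then show ?thesis using tc pos[of t] by (simp add: zero_le_divide_iff zero_le_mult_iff sym)
  qed
  then show ?thesis using that[of w] w ts word_H assms by (auto simp: chamber_def)
qed

end

end

section \<open>Orbit polytopes\<close>

context inner_form
begin

text \<open>The last term measures strict convexity: it bounds \<open>q\<close> on the hull and
  forbids a point of maximal \<open>q\<close> inside a proper segment.\<close>

lemma q_convex_combination:
  "q ((1 - u) *\<^sub>R a + u *\<^sub>R b) ((1 - u) *\<^sub>R a + u *\<^sub>R b) =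
     (1 - u) * q a a + u * q b b - u * (1 - u) * q (a - b) (a - b)"
  by (simp add: q_simps sym[of b a]) (simp add: algebra_simps)

lemma extreme_points_hull_sphere:
  assumes "finite Y" and norm: "\<And>y. y \<in> Y \<Longrightarrow> q y y = M"
  shows "{p. p extreme_point_of (convex hull Y)} = Y"
proof (intro equalityI subsetI CollectI)
  fix p assume "p \<in> {p. p extreme_point_of (convex hull Y)}"
  then show "p \<in> Y" using extreme_point_of_convex_hull by auto
next
  fix p assume p: "p \<in> Y"
  have convex: "convex {a. q a a \<le> M}"
    unfolding convex_alt
  proof (clarify)
    fix a b :: 'a and u :: real
    assume *: "q a a \<le> M" "q b b \<le> M" "0 \<le> u" "u \<le> 1"
    have "(1 - u) * q a a + u * q b b \<le> (1 - u) * M + u * M"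
      using * by (intro add_mono mult_left_mono) auto
    moreover have "u * (1 - u) * q (a - b) (a - b) \<ge> 0" using * nonneg by simp
    ultimately show "q ((1 - u) *\<^sub>R a + u *\<^sub>R b) ((1 - u) *\<^sub>R a + u *\<^sub>R b) \<le> M"
      unfolding q_convex_combination by (simp add: algebra_simps)
  qed
  have le: "q a a \<le> M" if "a \<in> convex hull Y" for a
    using hull_minimal[of Y "{a. q a a \<le> M}" convex] norm convex that by auto
  show "p extreme_point_of (convex hull Y)"
    unfolding extreme_point_of_def
  proof (intro conjI ballI)
    show "p \<in> convex hull Y" using p by (rule hull_inc)
    fix a b assume ab: "a \<in> convex hull Y" "b \<in> convex hull Y"
    show "p \<notin> open_segment a b"
    proof
      assume "p \<in> open_segment a b"
      then obtain u where u: "a \<noteq> b" "0 < u" "u < 1" "p = (1 - u) *\<^sub>R a + u *\<^sub>R b"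
        by (auto simp: in_segment)
      have "(1 - u) * q a a + u * q b b \<le> (1 - u) * M + u * M"
        using u le ab by (intro add_mono mult_left_mono) auto
      moreover have "u * (1 - u) * q (a - b) (a - b) > 0" using u pos[of "a - b"] by simp
      ultimately have "q p p < M"
        unfolding u(4) q_convex_combination by (simp add: algebra_simps)
      then show False using norm[OF p] by simp
    qed
  qed
qed

end

section \<open>Extreme points of the polytope and closed chambers\<close>

context finite_reflections
begin

lemma W_comp: "v \<in> W \<Longrightarrow> w \<in> W \<Longrightarrow> v \<circ> w \<in> W"
  unfolding W_def using word_append by (smt (verit) imageE imageI append_in_lists_conv)

lemma W_linear: "w \<in> W \<Longrightarrow> linear w"
  by (auto simp: W_def linear_word)

lemma W_orthogonal: "w \<in> W \<Longrightarrow> q (w x) (w y) = q x y"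
  by (auto simp: W_def word_orthogonal)

lemma W_H: "w \<in> W \<Longrightarrow> x \<in> H \<Longrightarrow> w x \<in> H"
  unfolding W_def using word_H by auto

lemma W_inverse:
  assumes "w \<in> W"
  obtains v where "v \<in> W" "\<And>x. v (w x) = x" "\<And>x. w (v x) = x"
proof -
  obtain ts where "set ts \<subseteq> R" "w = word ts" using assms by (auto simp: W_def)
  then show ?thesis using that[of "word (rev ts)"] word_rev word_rev'
    by (metis W_def imageI in_lists_conv_set set_rev subset_iff)
qed

theorem extreme_points_orbit_polytope:
  assumes regular: "\<And>t. t \<in> R \<Longrightarrow> q t c \<noteq> 0"
    and w0: "w0 \<in> W" "w0 ` chamber c = uminus ` chamber c"
    and X: "X \<subseteq> chamber c" "\<xi> \<in> X"
    and dominant: "\<And>z x. z \<in> chamber c \<Longrightarrow> x \<in> X \<Longrightarrow> q z x \<le> q z \<xi>"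
  shows "{p. p extreme_point_of (hofer_polytope W X)} = (\<lambda>w. w (\<xi> - w0 \<xi>)) ` W"
proof -
  let ?y = "\<xi> - w0 \<xi>" and ?G = "{w x - w' x' | w w' x x'. w \<in> W \<and> w' \<in> W \<and> x \<in> X \<and> x' \<in> X}"
  define Y where "Y = (\<lambda>w. w ?y) ` W"
  have neg_w0: "- w0 x \<in> chamber c" if x: "x \<in> chamber c" for x
  proof -
    have "w0 x \<in> uminus ` chamber c" using w0 x by blast
    then show ?thesis by auto
  qed
  obtain v0 where v0: "v0 \<in> W" "\<And>x. v0 (w0 x) = x" "\<And>x. w0 (v0 x) = x"
    using W_inverse[OF w0(1)] by blast
  have support: "q z (w x - w' x') \<le> q z ?y"
    if z: "z \<in> chamber c" and w: "w \<in> W" "w' \<in> W" and x: "x \<in> X" "x' \<in> X" for z w w' x x'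
  proof -
    have xc: "x \<in> chamber c" "x' \<in> chamber c" using x X by auto
    have "q z (w x) \<le> q z x" using W_chamber_le[OF regular w(1) xc(1) z] .
    also have "\<dots> \<le> q z \<xi>" using dominant z x by blast
    finally have 1: "q z (w x) \<le> q z \<xi>" .
    \<comment> \<open>\<open>- w' x'\<close> lies in the orbit of the dominant point
      \<open>- w0 x'\<close>: apply \<open>w'\<close> after the inverse \<open>v0\<close> of
      \<open>w0\<close>.\<close>
    have "q z ((w' \<circ> v0) (- w0 x')) \<le> q z (- w0 x')"
      using W_chamber_le[OF regular W_comp[OF w(2) v0(1)] neg_w0[OF xc(2)] z] .
    then have 2: "q z (- w' x') \<le> q z (- w0 x')"
      using W_linear[OF w(2)] W_linear[OF v0(1)] by (simp add: linear_neg v0)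
    \<comment> \<open>Moving \<open>w0\<close> across the form turns <z, - w0 u> into <p, u> with
      \<open>p\<close> in the chamber, and there \<open>\<xi>\<close> is maximal by
      assumption.\<close>
    obtain p where p: "p \<in> chamber c" "w0 p = - z"
      using w0(2) z by (metis (no_types, lifting) imageE imageI)
    have flip: "q z (- w0 u) = q p u" for u
    proof -
      have "q z (- w0 u) = q (- z) (w0 u)" by (simp add: q_simps)
      then show ?thesis using W_orthogonal[OF w0(1), of p u] p by simp
    qed
    have "q z (- w0 x') \<le> q z (- w0 \<xi>)" unfolding flip using dominant p x by blast
    with 1 2 show ?thesis by (simp add: q_simps)
  qed
  have finY: "finite Y" using finite_W by (simp add: Y_def)
  have yH: "?y \<in> H" using X w0 W_H subspace_H by (auto simp: chamber_def intro!: subspace_diff)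
  have YH: "Y \<subseteq> H" using yH W_H by (auto simp: Y_def)
  have GH: "?G \<subseteq> H" using X W_H subspace_H by (auto simp: chamber_def intro!: subspace_diff)
  have "Y \<subseteq> ?G"
  proof
    fix p assume "p \<in> Y"
    then obtain w where w: "w \<in> W" "p = w ?y" by (auto simp: Y_def)
    have "p = w \<xi> - (w \<circ> w0) \<xi>" using w W_linear linear_diff by auto
    then show "p \<in> ?G" using w W_comp[OF w(1) w0(1)] X by blast
  qed
  moreover have "g \<in> convex hull Y" if g: "g \<in> ?G" for g
  proof (rule ccontr)
    assume "g \<notin> convex hull Y"
    moreover have "closed (convex hull Y)" using finY by (simp add: finite_imp_compact_convex_hull compact_imp_closed)
    ultimately obtain a b where ab: "a \<bullet> g < b" "\<And>y. y \<in> convex hull Y \<Longrightarrow> b < a \<bullet> y"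
      using separating_hyperplane_closed_point[OF convex_convex_hull] by metis
    \<comment> \<open>The separation puts \<open>g\<close> on the lower side, hence the sign. The
      vector \<open>z\<close> representing the functional on \<open>H\<close> is moved into the
      chamber, where \<open>support\<close> applies; moving back by \<open>v\<close> gives an orbit
      point with at least the value of \<open>g\<close>, against the separation.\<close>
    have "linear (\<lambda>v. - (a \<bullet> v))" by (rule linearI) (simp_all add: inner_add_right)
    then obtain z where z: "z \<in> H" "\<And>v. v \<in> H \<Longrightarrow> - (a \<bullet> v) = q z v"
      using riesz[OF subspace_H] by metis
    obtain w where w: "w \<in> W" "w z \<in> chamber c" using W_into_chamber[OF regular z(1)] by blast
    obtain v where v: "v \<in> W" "\<And>x. v (w x) = x" "\<And>x. w (v x) = x" using W_inverse[OF w(1)] by blast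
    obtain w1 w2 x1 x2 where g': "g = w1 x1 - w2 x2" "w1 \<in> W" "w2 \<in> W" "x1 \<in> X" "x2 \<in> X"
      using g by auto
    have "q z g = q (w z) (w g)" using W_orthogonal[OF w(1)] by simp
    also have "w g = (w \<circ> w1) x1 - (w \<circ> w2) x2" using g' W_linear[OF w(1)] by (simp add: linear_diff)
    also have "q (w z) \<dots> \<le> q (w z) ?y"
      using support[OF w(2) W_comp[OF w(1) g'(2)] W_comp[OF w(1) g'(3)] g'(4,5)] .
    also have "\<dots> = q (w z) (w (v ?y))" by (simp add: v)
    also have "\<dots> = q z (v ?y)" using W_orthogonal[OF w(1)] by simp
    finally have le: "q z g \<le> q z (v ?y)" .
    have vy: "v ?y \<in> Y" using v by (auto simp: Y_def)
    have "- (a \<bullet> g) = q z g" "- (a \<bullet> v ?y) = q z (v ?y)"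
      using z(2) subsetD[OF GH g] subsetD[OF YH vy] by blast+
    then show False
      using le ab(1) ab(2)[OF hull_inc[OF vy]] by linarith
  qed
  ultimately have "hofer_polytope W X = convex hull Y"
    using hull_mono[of Y ?G convex] hull_minimal[of ?G "convex hull Y" convex] convex_convex_hull
    unfolding hofer_polytope_def by (metis (no_types, lifting) equalityI subsetI)
  then show ?thesis
    using extreme_points_hull_sphere[OF finY, of "q ?y ?y"] W_orthogonal unfolding Y_def by force
qed

text \<open>No root changes sign on the connected set \<open>C\<close>, and the set \<open>S\<close>
  of points with the signs of \<open>c\<close> is convex, hence connected; so \<open>C = S\<close>
  by maximality. Points of \<open>chamber c\<close> are reached from \<open>S\<close> by adding
  small multiples of \<open>c\<close>.\<close>

lemma closure_component:
  assumes "C \<in> components {x \<in> H. \<forall>t\<in>R. q t x \<noteq> 0}"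
  obtains c where "\<And>t. t \<in> R \<Longrightarrow> q t c \<noteq> 0" "closure C = chamber c"
proof -
  let ?A = "{x \<in> H. \<forall>t\<in>R. q t x \<noteq> 0}"
  have C: "connected C" "C \<subseteq> ?A" "C \<noteq> {}"
    using assms in_components_connected in_components_subset in_components_nonempty by blast+
  then obtain c where c: "c \<in> C" by blast
  then have cH: "c \<in> H" and regular: "\<And>t. t \<in> R \<Longrightarrow> q t c \<noteq> 0" using C by auto
  define S where "S = {x \<in> H. \<forall>t\<in>positive_roots c. q t x > 0}"
  have cont: "continuous_on A (q t)" for t A
    using linear_continuous_on[of "q t"] linear_conv_bounded_linear lin_right by blast
  have "C \<subseteq> S"
  proof
    fix x assume x: "x \<in> C"
    have "q t x > 0" if t: "t \<in> positive_roots c" for t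
    proof (rule ccontr)
      assume "\<not> q t x > 0"
      moreover have "connected (q t ` C)" using connected_continuous_image[OF cont C(1)] .
      moreover have "q t c > 0" using t by (simp add: positive_roots_def)
      ultimately have "0 \<in> q t ` C"
        using connected_contains_Icc[of "q t ` C" "q t x" "q t c"] x c by auto
      then show False using C t by (auto simp: positive_roots_def)
    qed
    then show "x \<in> S" using x C by (auto simp: S_def)
  qed
  moreover have "S \<subseteq> C"
  proof (rule components_maximal[OF assms])
    have "S = H \<inter> (\<Inter>t\<in>positive_roots c. {x. q t x > 0})" by (auto simp: S_def)
    moreover have "convex {x. q t x > 0}" for t
    proof -
      have "{x. q t x > 0} = q t -` {0<..}" by auto
      then show ?thesis using convex_linear_vimage[OF lin_right, of "{0<..}"] by auto
    qed
    ultimately show "connected S"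
      using subspace_imp_convex[OF subspace_H] by (auto intro!: convex_connected convex_Int convex_INT)
    show "S \<subseteq> ?A"
    proof (clarsimp simp: S_def)
      fix x t assume x: "\<forall>t\<in>positive_roots c. 0 < q t x" "x \<in> H" and t: "t \<in> R" "q t x = 0"
      show False using x t uminus_positive[OF regular t(1)] by (cases "t \<in> positive_roots c") (force simp: q_simps)+
    qed
    show "C \<inter> S \<noteq> {}" using \<open>C \<subseteq> S\<close> C by blast
  qed
  ultimately have CS: "C = S" by simp
  have "closure S = chamber c"
  proof
    have "chamber c = H \<inter> (\<Inter>t\<in>positive_roots c. {x. q t x \<ge> 0})" by (auto simp: chamber_def)
    moreover have "closed {x. q t x \<ge> 0}" for t
      by (rule closed_Collect_le) (auto intro: cont)
    ultimately have "closed (chamber c)"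
      using closed_subspace[OF subspace_H] by (auto intro!: closed_Int closed_INT)
    then show "closure S \<subseteq> chamber c"
      by (rule closure_minimal[rotated]) (auto simp: S_def chamber_def less_imp_le)
    show "chamber c \<subseteq> closure S"
    proof
      fix x assume x: "x \<in> chamber c"
      show "x \<in> closure S" unfolding closure_approachable
      proof (intro allI impI)
        fix e :: real assume e: "e > 0"
        \<comment> \<open>The summand 1 keeps the quotient meaningful for \<open>c = 0\<close>, a
          case that occurs only if \<open>R\<close> is empty.\<close>
        define k where "k = e / (2 * (norm c + 1))"
        have n: "norm c + 1 > 0" by (smt (verit) norm_ge_zero)
        have k: "k > 0" using e n by (simp add: k_def)
        have "x + k *\<^sub>R c \<in> S"
          using x k cH subspace_H
          by (auto simp: S_def chamber_def q_simps positive_roots_def subspace_add subspace_scale intro!: add_nonneg_pos)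
        moreover have "k * norm c < e"
        proof -
          have "k * norm c \<le> k * (norm c + 1)" using k by simp
          also have "\<dots> = e / 2" using n by (simp add: k_def field_simps)
          finally show ?thesis using e by simp
        qed
        then have "dist (x + k *\<^sub>R c) x < e" using k by (simp add: dist_norm)
        ultimately show "\<exists>y\<in>S. dist y x < e" by blast
      qed
    qed
  qed
  then show ?thesis using that[of c] regular CS by simp
qed

end

section \<open>Invariant inner products\<close>

text \<open>Kakutani's argument: the norm \<open>v \<mapsto> sup \<parallel>g v\<parallel>\<close> is invariant and, by the parallelogram
  law, uniformly convex, so its minimiser on \<open>S\<close> is unique and hence a fixed point.\<close>

lemma Kakutani_fixed_point:
  fixes \<G> :: "('v::euclidean_space \<Rightarrow> 'v) set"
  assumes nonempty: "\<G> \<noteq> {}"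
    and lin: "\<And>g. g \<in> \<G> \<Longrightarrow> linear g"
    and comp: "\<And>g h. g \<in> \<G> \<Longrightarrow> h \<in> \<G> \<Longrightarrow> h \<circ> g \<in> \<G>"
    and upper: "\<And>g v. g \<in> \<G> \<Longrightarrow> norm (g v) \<le> C * norm v"
    and lower: "\<And>g v. g \<in> \<G> \<Longrightarrow> norm v \<le> C * norm (g v)"
    and S: "compact S" "convex S" "S \<noteq> {}"
    and inv: "\<And>g v. g \<in> \<G> \<Longrightarrow> v \<in> S \<Longrightarrow> g v \<in> S"
  obtains s where "s \<in> S" "\<And>g. g \<in> \<G> \<Longrightarrow> g s = s"
proof -
  define f where "f v = (SUP g\<in>\<G>. norm (g v))" for v
  have bdd: "bdd_above ((\<lambda>g. norm (g v)) ` \<G>)" for v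
    using upper by (auto intro!: bdd_aboveI)
  have le_f: "norm (g v) \<le> f v" if "g \<in> \<G>" for g v
    unfolding f_def using that bdd by (rule cSUP_upper)
  have f_le: "f v \<le> c" if "\<And>g. g \<in> \<G> \<Longrightarrow> norm (g v) \<le> c" for v c
    unfolding f_def using that nonempty by (intro cSUP_least) auto
  have f_upper: "f v \<le> C * norm v" for v using f_le upper by blast
  have f_diff: "f v \<le> f w + f (v - w)" for v w
  proof (rule f_le)
    fix g assume g: "g \<in> \<G>"
    have "norm (g v) \<le> norm (g w) + norm (g (v - w))"
      using norm_triangle_ineq[of "g w" "g (v - w)"] lin[OF g] by (simp add: linear_diff)
    then show "norm (g v) \<le> f w + f (v - w)" using le_f[OF g, of w] le_f[OF g, of "v - w"] by linarith
  qed
  have f_dist: "\<bar>f v - f w\<bar> \<le> C * norm (v - w)" for v w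
    using f_diff[of v w] f_diff[of w v] f_upper[of "v - w"] f_upper[of "w - v"]
    by (simp add: norm_minus_commute[of w v])
  have f0: "f v \<ge> 0" for v using le_f nonempty norm_ge_zero order_trans by blast
  have "\<bar>C\<bar>-lipschitz_on UNIV f"
  proof (intro lipschitz_onI)
    fix v w :: 'v
    have "C * norm (v - w) \<le> \<bar>C\<bar> * norm (v - w)" by (intro mult_right_mono) auto
    then show "dist (f v) (f w) \<le> \<bar>C\<bar> * dist v w" using f_dist[of v w] by (simp add: dist_norm)
  qed auto
  then have "continuous_on S f" using lipschitz_on_continuous_on continuous_on_subset by blast
  then obtain s where s: "s \<in> S" "\<And>t. t \<in> S \<Longrightarrow> f s \<le> f t"
    using continuous_attains_inf[OF S(1,3)] by blast
  have unique: "t = s" if t: "t \<in> S" "f t \<le> f s" for t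
  proof (rule ccontr)
    assume "t \<noteq> s"
    define m where "m = (1/2) *\<^sub>R s + (1/2) *\<^sub>R t"
    have m: "m \<in> S" unfolding m_def using S(2) s t by (intro convexD) auto
    have n0: "norm (s - t) > 0" using \<open>t \<noteq> s\<close> by simp
    have C: "C > 0"
    proof -
      obtain g where "g \<in> \<G>" using nonempty by blast
      then have "0 < C * norm (g (s - t))" using lower[of g "s - t"] n0 by linarith
      then show ?thesis using norm_ge_zero[of "g (s - t)"] by (auto simp: zero_less_mult_iff)
    qed
    \<comment> \<open>The parallelogram law makes \<open>g m\<close> shorter than \<open>f s\<close>
      by at least this amount in squared norm. By \<open>lower\<close> the amount is uniform in
      \<open>g\<close>, so the gain survives the supremum.\<close>
    define k where "k = (norm (s - t) / C)\<^sup>2 / 4"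
    have k: "k > 0" using n0 C by (simp add: k_def)
    have gm: "(norm (g m))\<^sup>2 \<le> (f s)\<^sup>2 - k" if g: "g \<in> \<G>" for g
    proof -
      have "g m = (1/2) *\<^sub>R (g s + g t)" using lin[OF g]
        by (simp add: m_def linear_add linear_scale scaleR_add_right)
      then have "(norm (g m))\<^sup>2 = (norm (g s + g t))\<^sup>2 / 4" by (simp add: power_divide)
      also have "\<dots> = (norm (g s))\<^sup>2 / 2 + (norm (g t))\<^sup>2 / 2 - (norm (g s - g t))\<^sup>2 / 4"
      proof -
        have "(norm (g s + g t))\<^sup>2 + (norm (g s - g t))\<^sup>2 = 2 * (norm (g s))\<^sup>2 + 2 * (norm (g t))\<^sup>2"
          by (simp add: power2_norm_eq_inner inner_add_left inner_add_right inner_diff_left inner_diff_right)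
        then show ?thesis by linarith
      qed
      also have "g s - g t = g (s - t)" using lin[OF g] by (simp add: linear_diff)
      finally have eq: "(norm (g m))\<^sup>2 = (norm (g s))\<^sup>2 / 2 + (norm (g t))\<^sup>2 / 2 - (norm (g (s - t)))\<^sup>2 / 4" .
      have "norm (s - t) / C \<le> norm (g (s - t))" using lower[OF g, of "s - t"] C by (simp add: field_simps)
      then have "(norm (s - t) / C)\<^sup>2 \<le> (norm (g (s - t)))\<^sup>2" using C by (intro power_mono) auto
      moreover have "(norm (g s))\<^sup>2 \<le> (f s)\<^sup>2" "(norm (g t))\<^sup>2 \<le> (f s)\<^sup>2"
        using le_f[OF g, of s] le_f[OF g, of t] t by (intro power_mono; force)+
      ultimately show ?thesis using eq by (simp add: k_def)
    qed
    have "(f s)\<^sup>2 - k \<ge> 0" using gm nonempty zero_le_power2 order_trans by blast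
    then have "f m \<le> sqrt ((f s)\<^sup>2 - k)"
      using gm by (intro f_le) (simp add: real_le_rsqrt)
    also have "\<dots> < sqrt ((f s)\<^sup>2)" using k by (simp only: real_sqrt_less_iff)
    also have "\<dots> = f s" using f0 by simp
    finally show False using s(2)[OF m] by simp
  qed
  show ?thesis
  proof (rule that[OF s(1)])
    fix g assume g: "g \<in> \<G>"
    have "f (g s) \<le> f s" using le_f[OF comp[OF g]] by (intro f_le) auto
    then show "g s = s" using unique inv g s by blast
  qed
qed

text \<open>In place of averaging over the group: the matrices act on forms by S \<mapsto> A^T S A,
  the closed convex hull of the Gram matrices A^T A is compact and stable, and a fixed point in it
  is an invariant form.\<close>

lemma invariant_inner_form_exists:
  fixes G :: "(real^'n^'n) set" and M :: real
  assumes one: "mat 1 \<in> G"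
    and mult: "\<And>A B. A \<in> G \<Longrightarrow> B \<in> G \<Longrightarrow> A ** B \<in> G"
    and inv: "\<And>A. A \<in> G \<Longrightarrow> \<exists>B\<in>G. A ** B = mat 1"
    and bound: "\<And>A x. A \<in> G \<Longrightarrow> norm (A *v x) \<le> M * norm x"
  obtains B where "inner_form B" "\<And>A x y. A \<in> G \<Longrightarrow> B (A *v x) (A *v y) = B x y"
proof -
  define act :: "real^'n^'n \<Rightarrow> real^'n^'n \<Rightarrow> real^'n^'n" where "act A S = transpose A ** S ** A" for A S
  have bil: "bilinear ((**) :: real^'n^'n \<Rightarrow> real^'n^'n \<Rightarrow> real^'n^'n)"
    unfolding bilinear_def
    by (auto intro!: linearI simp: vec_eq_iff matrix_matrix_mult_def sum.distrib algebra_simps sum_distrib_left)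
  have lin_tr: "linear (transpose :: real^'n^'n \<Rightarrow> real^'n^'n)"
    by (auto intro!: linearI simp: transpose_def vec_eq_iff)
  have lin_act: "linear (act A)" for A
    by (rule linearI) (simp_all add: act_def bilinear_radd[OF bil] bilinear_ladd[OF bil]
        bilinear_rmul[OF bil] bilinear_lmul[OF bil])
  have act_act: "act B (act A S) = act (A ** B) S" for A B S
    by (simp add: act_def matrix_transpose_mul matrix_mul_assoc)
  have act_one: "act (mat 1) S = S" for S
    by (simp add: act_def)
  have act_form: "x \<bullet> (act A S *v y) = (A *v x) \<bullet> (S *v (A *v y))" for A S x y
    by (metis act_def dot_lmul_matrix matrix_vector_mul_assoc vector_transpose_matrix inner_commute transpose_transpose)
  obtain c1 where c1: "c1 > 0" "\<And>(A :: real^'n^'n) (B :: real^'n^'n). norm (A ** B) \<le> c1 * norm A * norm B"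
    using bilinear_bounded_pos[OF bil] by metis
  obtain c2 where c2: "c2 > 0" "\<And>A :: real^'n^'n. norm (transpose A) \<le> c2 * norm A"
    using linear_bounded_pos[OF lin_tr] by metis
  have M: "M \<ge> 1"
  proof -
    obtain x :: "real^'n" where "norm x = 1" using vector_choose_size[of 1] by auto
    then show ?thesis using bound[OF one, of x] by simp
  qed
  \<comment> \<open>Entries are bounded by \<open>M\<close>, rows by their number of entries times
    that, and the matrix by the sum of its rows.\<close>
  define N where "N = real CARD('n) * (real CARD('n) * M)"
  have norm_G: "norm A \<le> N" if "A \<in> G" for A
  proof -
    have entry: "\<bar>A $ i $ j\<bar> \<le> M" for i j
    proof -
      have "\<bar>A $ i $ j\<bar> = \<bar>(A *v axis j 1) $ i\<bar>" by (simp add: matrix_vector_mul_component inner_axis)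
      also have "\<dots> \<le> norm (A *v axis j 1)" by (rule component_le_norm_cart)
      also have "\<dots> \<le> M" using bound[OF that, of "axis j 1"] by simp
      finally show ?thesis .
    qed
    have "norm (A $ i) \<le> real CARD('n) * M" for i
      by (rule order_trans[OF norm_le_l1_cart]) (use sum_bounded_above[of UNIV "\<lambda>j. \<bar>A $ i $ j\<bar>" M] entry in auto)
    moreover have "norm A \<le> (\<Sum>i\<in>UNIV. norm (A $ i))"
      unfolding norm_vec_def by (rule L2_set_le_sum) simp
    ultimately show ?thesis unfolding N_def using sum_bounded_above[of UNIV "\<lambda>i. norm (A $ i)"] by force
  qed
  have N0: "N \<ge> 0" using norm_G[OF one] norm_ge_zero order_trans by blast
  define D where "D = c1 * (c1 * (c2 * N)) * N"
  have act_bound: "norm (act A S) \<le> D * norm S" if A: "A \<in> G" for A S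
  proof -
    have "norm (act A S) \<le> c1 * norm (transpose A ** S) * norm A"
      unfolding act_def by (rule c1)
    also have "\<dots> \<le> c1 * (c1 * (c2 * N) * norm S) * N"
    proof -
      have "norm (transpose A) \<le> c2 * N"
        using c2(2)[of A] norm_G[OF A] c2(1) by (meson mult_left_mono less_imp_le order_trans)
      then have "c1 * norm (transpose A) * norm S \<le> c1 * (c2 * N) * norm S"
        using c1(1) by (intro mult_right_mono mult_left_mono) auto
      then have "norm (transpose A ** S) \<le> c1 * (c2 * N) * norm S" using c1(2)[of "transpose A" S] by linarith
      then show ?thesis using norm_G[OF A] c1(1) c2(1) N0 by (intro mult_mono) auto
    qed
    finally show ?thesis by (simp add: D_def mult_ac)
  qed
  define P where "P = (\<lambda>A. transpose A ** A) ` G"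
  define S where "S = closure (convex hull P)"
  have "bounded P" unfolding P_def
  proof (rule boundedI)
    fix T assume "T \<in> (\<lambda>A. transpose A ** A) ` G"
    then obtain A where "A \<in> G" "T = act A (mat 1)" by (auto simp: act_def)
    then show "norm T \<le> D * norm (mat 1 :: real^'n^'n)" using act_bound by simp
  qed
  then have compact: "compact S"
    by (simp add: S_def compact_closure bounded_convex_hull)
  have inv': "\<exists>B\<in>G. B ** A = mat 1" if A: "A \<in> G" for A
    using inv[OF A] matrix_left_right_inverse by metis
  obtain T where T: "T \<in> S" "\<And>g. g \<in> act ` G \<Longrightarrow> g T = T"
  proof (rule Kakutani_fixed_point[of "act ` G" D S])
    show "act ` G \<noteq> {}" using one by auto
    show "linear g" if "g \<in> act ` G" for g using that lin_act by auto
    show "h \<circ> g \<in> act ` G" if "g \<in> act ` G" "h \<in> act ` G" for g h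
    proof -
      obtain A B where "A \<in> G" "B \<in> G" "g = act A" "h = act B"
        using \<open>g \<in> act ` G\<close> \<open>h \<in> act ` G\<close> by auto
      then have "h \<circ> g = act (A ** B)" by (auto simp: fun_eq_iff act_act)
      then show ?thesis using mult \<open>A \<in> G\<close> \<open>B \<in> G\<close> by blast
    qed
    show "norm (g v) \<le> D * norm v" if "g \<in> act ` G" for g v using that act_bound by auto
    show "norm v \<le> D * norm (g v)" if "g \<in> act ` G" for g v
    proof -
      obtain A where "A \<in> G" "g = act A" using \<open>g \<in> act ` G\<close> by auto
      moreover obtain B where "B \<in> G" "A ** B = mat 1" using inv \<open>A \<in> G\<close> by blast
      ultimately show ?thesis using act_bound[of B "g v"] by (simp add: act_act act_one)
    qed
    show "convex S" "S \<noteq> {}" using one by (auto simp: S_def P_def intro: convex_closure)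
    show "g v \<in> S" if g: "g \<in> act ` G" and v: "v \<in> S" for g v
    proof -
      obtain A where A: "A \<in> G" "g = act A" using g by auto
      have "act A ` P \<subseteq> P"
      proof (clarsimp simp: P_def)
        fix B assume "B \<in> G"
        have "act A (transpose B ** B) = transpose (B ** A) ** (B ** A)"
          by (simp add: act_def matrix_transpose_mul matrix_mul_assoc)
        then show "act A (transpose B ** B) \<in> (\<lambda>A. transpose A ** A) ` G"
          using mult[OF \<open>B \<in> G\<close> A(1)] by blast
      qed
      then have "act A ` (convex hull P) \<subseteq> convex hull P"
        by (simp add: convex_hull_linear_image[OF lin_act] hull_mono)
      then show ?thesis
        using closure_linear_image_subset[OF lin_act, of A "convex hull P"] v A closure_mono
        unfolding S_def by blast
    qed
  qed (use compact in auto)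
  \<comment> \<open>Positivity is recorded as a closed condition, since a strict inequality could be
    lost in the closure. The factor comes from applying \<open>bound\<close> to the inverse of
    \<open>A\<close>: |x| \<le> M |A x|.\<close>
  define Q where "Q = {T :: real^'n^'n. (\<forall>x y. x \<bullet> (T *v y) = y \<bullet> (T *v x)) \<and> (\<forall>x. x \<bullet> x \<le> M\<^sup>2 * (x \<bullet> (T *v x)))}"
  have lin_entry: "linear (\<lambda>T :: real^'n^'n. x \<bullet> (T *v y))" for x y
    by (rule linearI)
       (simp_all add: matrix_vector_mult_add_rdistrib inner_add_right flip: scaleR_matrix_vector_assoc)
  have "S \<subseteq> Q" unfolding S_def
  proof (rule closure_minimal, rule hull_minimal)
    show "P \<subseteq> Q"
    proof (clarsimp simp: P_def Q_def, intro conjI allI)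
      fix A x y assume A: "A \<in> G"
      have eq: "x \<bullet> ((transpose A ** A) *v y) = (A *v x) \<bullet> (A *v y)" for x y
        using act_form[of x A "mat 1" y] by (simp add: act_def)
      show "x \<bullet> ((transpose A ** A) *v y) = y \<bullet> ((transpose A ** A) *v x)"
        by (simp add: eq inner_commute)
      obtain B where B: "B \<in> G" "B ** A = mat 1" using inv' A by blast
      have "norm x \<le> M * norm (A *v x)" using bound[OF B(1), of "A *v x"] B(2)
        by (simp add: matrix_vector_mul_assoc)
      then have "(norm x)\<^sup>2 \<le> (M * norm (A *v x))\<^sup>2" by (intro power_mono) auto
      then show "x \<bullet> x \<le> M\<^sup>2 * (x \<bullet> ((transpose A ** A) *v x))"
        by (simp add: eq power_mult_distrib power2_norm_eq_inner)
    qed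
    have Q: "Q = (\<Inter>x. \<Inter>y. {T. x \<bullet> (T *v y) = y \<bullet> (T *v x)}) \<inter> (\<Inter>x. {T. x \<bullet> x \<le> M\<^sup>2 * (x \<bullet> (T *v x))})"
      by (auto simp: Q_def)
    have cont: "continuous_on UNIV (\<lambda>T :: real^'n^'n. x \<bullet> (T *v y))" for x y
      by (rule linear_continuous_on) (use lin_entry linear_conv_bounded_linear in blast)
    show "closed Q" unfolding Q
      by (intro closed_Int closed_INT ballI closed_Collect_eq closed_Collect_le continuous_intros cont)
    have "convex {T :: real^'n^'n. x \<bullet> (T *v y) = y \<bullet> (T *v x)}" for x y
      by (rule subspace_imp_convex)
         (simp add: subspace_def linear_add[OF lin_entry] linear_scale[OF lin_entry] linear_0[OF lin_entry])
    moreover have "convex {T :: real^'n^'n. x \<bullet> x \<le> M\<^sup>2 * (x \<bullet> (T *v x))}" for x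
    proof -
      have l: "linear (\<lambda>T :: real^'n^'n. M\<^sup>2 * (x \<bullet> (T *v x)))"
        using linear_compose_scale_right[OF lin_entry] by (simp add: scaleR_conv_of_real)
      have "{T :: real^'n^'n. x \<bullet> x \<le> M\<^sup>2 * (x \<bullet> (T *v x))} = (\<lambda>T. M\<^sup>2 * (x \<bullet> (T *v x))) -` {x \<bullet> x..}" by auto
      then show ?thesis using convex_linear_vimage[OF l] by simp
    qed
    ultimately show "convex Q" unfolding Q by (intro convex_Int convex_INT) auto
  qed
  then have TQ: "T \<in> Q" using T by blast
  show ?thesis
  proof (rule that[of "\<lambda>x y. x \<bullet> (T *v y)"])
    show "inner_form (\<lambda>x y. x \<bullet> (T *v y))"
    proof
      show "bilinear (\<lambda>x y. x \<bullet> (T *v y))"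
        by (auto simp: bilinear_def intro!: linearI
            simp: inner_add_left inner_add_right matrix_vector_right_distrib matrix_vector_mult_scaleR)
      show "x \<bullet> (T *v y) = y \<bullet> (T *v x)" for x y using TQ by (simp add: Q_def)
      show "x \<bullet> (T *v x) > 0" if "x \<noteq> 0" for x
      proof -
        have "0 < x \<bullet> x" "x \<bullet> x \<le> M\<^sup>2 * (x \<bullet> (T *v x))" using that TQ by (auto simp: Q_def)
        then have "0 < M\<^sup>2 * (x \<bullet> (T *v x))" by linarith
        then show ?thesis by (simp add: zero_less_mult_iff)
      qed
    qed
    show "(A *v x) \<bullet> (T *v (A *v y)) = x \<bullet> (T *v y)" if "A \<in> G" for A x y
      using act_form[of x A T y] T(2)[of "act A"] that by auto
  qed
qed

section \<open>The exponential of a linear map\<close>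

definition exp_map :: "('a::euclidean_space \<Rightarrow> 'a) \<Rightarrow> 'a \<Rightarrow> 'a" where
  "exp_map D x = (\<Sum>k. (1 / fact k) *\<^sub>R (D ^^ k) x)"

lemma summable_exp_map:
  fixes D :: "'a::euclidean_space \<Rightarrow> 'a"
  assumes "linear D"
  shows "summable (\<lambda>k. norm ((1 / fact k) *\<^sub>R (D ^^ k) x))"
proof -
  obtain K where K: "K > 0" "\<And>x. norm (D x) \<le> K * norm x" using linear_bounded_pos[OF assms] by metis
  have "norm ((D ^^ k) x) \<le> K ^ k * norm x" for k
  proof (induction k)
    case (Suc k)
    have "norm ((D ^^ Suc k) x) \<le> K * norm ((D ^^ k) x)" using K by simp
    also have "\<dots> \<le> K * (K ^ k * norm x)" using K Suc by (intro mult_left_mono) auto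
    finally show ?case by simp
  qed simp
  then have "norm ((1 / fact k) *\<^sub>R (D ^^ k) x) \<le> K ^ k /\<^sub>R fact k * norm x" for k
    by (simp add: divide_simps)
  then show ?thesis
    by (intro summable_comparison_test'[OF summable_mult2[OF summable_exp_generic[of K]], of 0]) simp
qed

lemma exp_map_sums:
  fixes D :: "'a::euclidean_space \<Rightarrow> 'a"
  assumes "linear D"
  shows "(\<lambda>k. (1 / fact k) *\<^sub>R (D ^^ k) x) sums exp_map D x"
  unfolding exp_map_def using summable_norm_cancel[OF summable_exp_map[OF assms]] by (rule summable_sums)

lemma linear_funpow: "linear (D :: 'a::real_vector \<Rightarrow> 'a) \<Longrightarrow> linear (D ^^ k)"
  by (induction k) (auto intro: linear_compose simp: id_def linear_ident simp del: comp_apply)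

lemma linear_exp_map:
  fixes D :: "'a::euclidean_space \<Rightarrow> 'a"
  assumes "linear D"
  shows "linear (exp_map D)"
proof (rule linearI)
  fix x y :: 'a and r :: real
  have "(\<lambda>k. (1 / fact k) *\<^sub>R (D ^^ k) (x + y)) sums (exp_map D x + exp_map D y)"
    using sums_add[OF exp_map_sums[OF assms] exp_map_sums[OF assms], of x y]
    by (simp add: linear_add[OF linear_funpow[OF assms]] scaleR_add_right)
  then show "exp_map D (x + y) = exp_map D x + exp_map D y"
    using exp_map_sums[OF assms] sums_unique2 by blast
  have "(\<lambda>k. (1 / fact k) *\<^sub>R (D ^^ k) (r *\<^sub>R x)) sums (r *\<^sub>R exp_map D x)"
    using sums_scaleR_right[OF exp_map_sums[OF assms, of x], of r]
    by (simp add: linear_scale[OF linear_funpow[OF assms]] mult.commute)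
  then show "exp_map D (r *\<^sub>R x) = r *\<^sub>R exp_map D x"
    using exp_map_sums[OF assms] sums_unique2 by blast
qed

lemma exp_map_zero:
  assumes "linear D" "D x = 0" shows "exp_map D x = x"
proof -
  have "(D ^^ k) x = (if k = 0 then x else 0)" for k
    using assms by (induction k) (auto simp: linear_0)
  then have "(\<lambda>k. (1 / fact k) *\<^sub>R (D ^^ k) x) = (\<lambda>k. if k = 0 then x else 0)" by auto
  then show ?thesis using exp_map_sums[OF assms(1), of x] sums_single[of 0 "\<lambda>_. x"] sums_unique2 by auto
qed

text \<open>\<open>D\<close> turns the plane of \<open>a\<close> and \<open>b\<close> with angular
  speed sqrt (p q) = pi, and time 1 is half a period. Two constants appear because \<open>a\<close>
  and \<open>b\<close> may differ in length.\<close>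

lemma exp_map_half_turn:
  fixes D :: "'a::euclidean_space \<Rightarrow> 'a"
  assumes D: "linear D" "D a = p *\<^sub>R b" "D b = - (q *\<^sub>R a)" "p * q = pi\<^sup>2"
  shows "exp_map D a = - a"
proof -
  have "(1 / fact k) *\<^sub>R (D ^^ k) a = (cos_coeff k * pi ^ k) *\<^sub>R a + (sin_coeff k * pi ^ k * (p / pi)) *\<^sub>R b" for k
  proof (induction k)
    case (Suc k)
    have "(1 / fact (Suc k)) *\<^sub>R (D ^^ Suc k) a = (1 / real (Suc k)) *\<^sub>R D ((1 / fact k) *\<^sub>R (D ^^ k) a)"
      by (simp add: linear_scale[OF D(1)] divide_simps)
    also have "\<dots> = (1 / real (Suc k)) *\<^sub>R ((cos_coeff k * pi ^ k * p) *\<^sub>R b - (sin_coeff k * pi ^ k * (p * q / pi)) *\<^sub>R a)"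
      by (simp add: Suc linear_add[OF D(1)] linear_scale[OF D(1)] D)
    also have "\<dots> = (cos_coeff (Suc k) * pi ^ Suc k) *\<^sub>R a + (sin_coeff (Suc k) * pi ^ Suc k * (p / pi)) *\<^sub>R b"
      by (simp add: cos_coeff_Suc sin_coeff_Suc D(4) scaleR_diff_right power2_eq_square mult_ac del: of_nat_Suc)
    finally show ?case .
  qed (simp add: cos_coeff_def sin_coeff_def)
  moreover have "(\<lambda>k. (cos_coeff k * pi ^ k) *\<^sub>R a + (sin_coeff k * pi ^ k * (p / pi)) *\<^sub>R b) sums
      (cos pi *\<^sub>R a + (sin pi * (p / pi)) *\<^sub>R b)"
    using cos_converges[of pi] sin_converges[of pi]
    by (intro sums_add sums_scaleR_left sums_mult2) (simp_all add: scaleR_conv_of_real)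
  ultimately show ?thesis using exp_map_sums[OF D(1), of a] sums_unique2 by fastforce
qed

text \<open>Expanding \<open>P\<close> in coordinates reduces the claim to the Cauchy product of
  scalar series.\<close>

lemma bilinear_Cauchy_product_sums:
  fixes P :: "'a::euclidean_space \<Rightarrow> 'b::euclidean_space \<Rightarrow> 'c::real_normed_vector"
  assumes P: "bilinear P" and a: "summable (\<lambda>k. norm (a k))" and b: "summable (\<lambda>k. norm (b k))"
  shows "(\<lambda>k. \<Sum>i\<le>k. P (a i) (b (k - i))) sums P (suminf a) (suminf b)"
proof -
  have P_eq: "P u v = (\<Sum>p\<in>Basis. \<Sum>q\<in>Basis. ((u \<bullet> p) * (v \<bullet> q)) *\<^sub>R P p q)" for u v
  proof -
    have "P u v = P (\<Sum>p\<in>Basis. (u \<bullet> p) *\<^sub>R p) (\<Sum>q\<in>Basis. (v \<bullet> q) *\<^sub>R q)"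
      by (simp add: euclidean_representation)
    also have "\<dots> = (\<Sum>p\<in>Basis. \<Sum>q\<in>Basis. ((u \<bullet> p) * (v \<bullet> q)) *\<^sub>R P p q)"
      by (subst bilinear_sum[OF P])
         (simp add: sum.cartesian_product bilinear_lmul[OF P] bilinear_rmul[OF P] case_prod_unfold mult.commute)
    finally show ?thesis .
  qed
  have coord: "summable (\<lambda>k. norm (f k \<bullet> p)) \<and> (\<Sum>k. f k \<bullet> p) = suminf f \<bullet> p"
    if f: "summable (\<lambda>k. norm (f k))" and "p \<in> Basis"
    for f :: "nat \<Rightarrow> 'd::euclidean_space" and p
  proof
    have "norm (f k \<bullet> p) \<le> norm (f k)" for k using Basis_le_norm[OF \<open>p \<in> Basis\<close>] by simp
    then show "summable (\<lambda>k. norm (f k \<bullet> p))"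
      by (intro summable_comparison_test'[OF f, of 0]) simp
    show "(\<Sum>k. f k \<bullet> p) = suminf f \<bullet> p"
      using bounded_linear.suminf[OF bounded_linear_inner_left summable_norm_cancel[OF f]] by simp
  qed
  have "(\<lambda>k. \<Sum>p\<in>Basis. \<Sum>q\<in>Basis. (\<Sum>i\<le>k. (a i \<bullet> p) * (b (k - i) \<bullet> q)) *\<^sub>R P p q) sums
      (\<Sum>p\<in>Basis. \<Sum>q\<in>Basis. ((suminf a \<bullet> p) * (suminf b \<bullet> q)) *\<^sub>R P p q)"
  proof (intro sums_sum sums_scaleR_left)
    fix p :: 'a and q :: 'b assume "p \<in> Basis" "q \<in> Basis"
    then show "(\<lambda>k. \<Sum>i\<le>k. (a i \<bullet> p) * (b (k - i) \<bullet> q)) sums ((suminf a \<bullet> p) * (suminf b \<bullet> q))"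
      using Cauchy_product_sums[of "\<lambda>k. a k \<bullet> p" "\<lambda>k. b k \<bullet> q"] coord[OF a, of p] coord[OF b, of q] by simp
  qed
  moreover have "(\<Sum>p\<in>Basis. \<Sum>q\<in>Basis. (\<Sum>i\<le>k. (a i \<bullet> p) * (b (k - i) \<bullet> q)) *\<^sub>R P p q)
      = (\<Sum>i\<le>k. P (a i) (b (k - i)))" for k
    by (subst P_eq) (simp add: scaleR_sum_left sum.swap[of _ "{..k}"])
  ultimately show ?thesis by (simp add: P_eq[of "suminf a" "suminf b"])
qed

text \<open>Three separate maps let it serve twice: with the bracket and one derivation it gives an
  automorphism, with an invariant form and \<open>F = 0\<close> an isometry. The proof is the
  binomial formula for \<open>F ^^ k\<close> on \<open>P x y\<close>, in normalised form.\<close>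

lemma exp_map_bilinear:
  fixes P :: "'a::euclidean_space \<Rightarrow> 'b::euclidean_space \<Rightarrow> 'c::euclidean_space"
  assumes P: "bilinear P" and lin: "linear D" "linear E" "linear F"
    and Leibniz: "\<And>x y. F (P x y) = P (D x) y + P x (E y)"
  shows "exp_map F (P x y) = P (exp_map D x) (exp_map E y)"
proof -
  define a where "a k = (1 / fact k) *\<^sub>R (D ^^ k) x" for k
  define b where "b k = (1 / fact k) *\<^sub>R (E ^^ k) y" for k
  define c where "c k = (1 / fact k) *\<^sub>R (F ^^ k) (P x y)" for k
  have Da: "D (a k) = real (Suc k) *\<^sub>R a (Suc k)" and Eb: "E (b k) = real (Suc k) *\<^sub>R b (Suc k)"
    and Fc: "F (c k) = real (Suc k) *\<^sub>R c (Suc k)" for k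
    by (simp_all add: a_def b_def c_def linear_scale[OF lin(1)] linear_scale[OF lin(2)] linear_scale[OF lin(3)]
        divide_simps del: of_nat_Suc)
  have "c k = (\<Sum>i\<le>k. P (a i) (b (k - i)))" for k
  proof (induction k)
    case (Suc k)
    have Eb': "E (b (k - i)) = real (Suc k - i) *\<^sub>R b (Suc k - i)" if "i \<le> k" for i
      using Eb[of "k - i"] that by (simp add: Suc_diff_le)
    have "real (Suc k) *\<^sub>R c (Suc k) = F (\<Sum>i\<le>k. P (a i) (b (k - i)))"
      by (simp only: Fc[symmetric] Suc)
    also have "\<dots> = (\<Sum>i\<le>k. P (D (a i)) (b (k - i))) + (\<Sum>i\<le>k. P (a i) (E (b (k - i))))"
      by (simp add: linear_sum[OF lin(3)] Leibniz sum.distrib)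
    also have "(\<Sum>i\<le>k. P (D (a i)) (b (k - i))) = (\<Sum>i\<le>k. real (Suc i) *\<^sub>R P (a (Suc i)) (b (Suc k - Suc i)))"
      by (simp add: Da bilinear_lmul[OF P] del: of_nat_Suc)
    \<comment> \<open>The term \<open>i = 0\<close> gained by the shift has weight 0, as has
      \<open>i = Suc k\<close> in the other sum below. The weights \<open>i\<close> and
      \<open>Suc k - i\<close> then add up to \<open>Suc k\<close> throughout.\<close>
    also have "\<dots> = (\<Sum>i\<le>Suc k. real i *\<^sub>R P (a i) (b (Suc k - i)))"
      by (subst sum.atMost_Suc_shift) simp
    also have "(\<Sum>i\<le>k. P (a i) (E (b (k - i)))) = (\<Sum>i\<le>k. real (Suc k - i) *\<^sub>R P (a i) (b (Suc k - i)))"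
      by (intro sum.cong) (simp_all add: Eb' bilinear_rmul[OF P] del: of_nat_Suc)
    also have "\<dots> = (\<Sum>i\<le>Suc k. real (Suc k - i) *\<^sub>R P (a i) (b (Suc k - i)))" by simp
    also have "(\<Sum>i\<le>Suc k. real i *\<^sub>R P (a i) (b (Suc k - i))) + \<dots>
        = (\<Sum>i\<le>Suc k. real (Suc k) *\<^sub>R P (a i) (b (Suc k - i)))"
      unfolding sum.distrib[symmetric] scaleR_add_left[symmetric]
      by (intro sum.cong) (simp_all add: of_nat_diff)
    finally have "real (Suc k) *\<^sub>R c (Suc k) = real (Suc k) *\<^sub>R (\<Sum>i\<le>Suc k. P (a i) (b (Suc k - i)))"
      by (simp only: scaleR_sum_right)
    then show ?case by (simp del: of_nat_Suc sum.atMost_Suc)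
  qed (simp add: a_def b_def c_def)
  then have "c = (\<lambda>k. \<Sum>i\<le>k. P (a i) (b (k - i)))" by (rule ext)
  moreover have "summable (\<lambda>k. norm (a k))" "summable (\<lambda>k. norm (b k))"
    unfolding a_def b_def by (rule summable_exp_map[OF lin(1)], rule summable_exp_map[OF lin(2)])
  ultimately have "c sums P (suminf a) (suminf b)"
    using bilinear_Cauchy_product_sums[OF P, of a b] by simp
  moreover have "c sums exp_map F (P x y)"
    unfolding c_def by (rule exp_map_sums[OF lin(3)])
  ultimately have "exp_map F (P x y) = P (suminf a) (suminf b)" by (rule sums_unique2[symmetric])
  then show ?thesis by (simp add: exp_map_def a_def[abs_def] b_def[abs_def])
qed

section \<open>Lie algebras with an invariant inner product\<close>

lemma trace_matrix_comp:
  fixes f g :: "real^'n \<Rightarrow> real^'n"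
  assumes "linear f" "linear g"
  shows "trace (matrix (\<lambda>x. f (g x))) = trace (matrix (\<lambda>x. g (f x)))"
  using matrix_compose[of g f] matrix_compose[of f g] assms trace_mul_sym[of "matrix f" "matrix g"]
  by (simp add: comp_def linear_matrix_vector_mul_eq)

lemma trace_matrix_diff: "trace (matrix (\<lambda>x. f x - g x)) = trace (matrix f) - trace (matrix g)"
  for f g :: "real^'n \<Rightarrow> real^'n"
  by (simp add: trace_def matrix_def sum_subtractf)

text \<open>Expand \<open>axis i 1\<close> over \<open>X\<close> and swap the sums. It makes the
  Killing form visible as a sum over a basis adapted to \<open>B\<close>.\<close>

lemma trace_matrix_orthonormal:
  fixes B :: "real^'n \<Rightarrow> real^'n \<Rightarrow> real"
  assumes B: "inner_form B" and f: "linear f"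
    and X: "finite X" "\<And>v. v = (\<Sum>b\<in>X. B v b *\<^sub>R b)"
  shows "trace (matrix f) = (\<Sum>b\<in>X. B (f b) b)"
proof -
  interpret inner_form B by (rule B)
  have "trace (matrix f) = (\<Sum>i\<in>UNIV. f (axis i 1) $ i)"
    by (simp add: trace_def matrix_def)
  also have "\<dots> = (\<Sum>i\<in>UNIV. \<Sum>b\<in>X. B (axis i 1) b * f b $ i)"
  proof (intro sum.cong HOL.refl)
    fix i :: 'n
    have "f (axis i 1) = f (\<Sum>b\<in>X. B (axis i 1) b *\<^sub>R b)" using X(2)[of "axis i 1"] by simp
    also have "\<dots> = (\<Sum>b\<in>X. B (axis i 1) b *\<^sub>R f b)" by (simp add: linear_sum[OF f] linear_scale[OF f])
    finally show "f (axis i 1) $ i = (\<Sum>b\<in>X. B (axis i 1) b * f b $ i)" by simp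
  qed
  also have "\<dots> = (\<Sum>b\<in>X. \<Sum>i\<in>UNIV. B (axis i 1) b * f b $ i)" by (rule sum.swap)
  also have "\<dots> = (\<Sum>b\<in>X. B (\<Sum>i\<in>UNIV. (f b $ i) *\<^sub>R axis i 1) b)"
    by (simp add: q_simps mult.commute)
  also have "\<dots> = (\<Sum>b\<in>X. B (f b) b)"
  proof -
    have "(\<Sum>i\<in>UNIV. (v $ i) *\<^sub>R axis i 1) = v" for v :: "real^'n"
      using basis_expansion[of v] by (simp add: scalar_mult_eq_scaleR)
    then show ?thesis by simp
  qed
  finally show ?thesis .
qed

text \<open>Compactness enters through \<open>B\<close>, an inner product for which every
  \<open>br x\<close> is skew.\<close>

locale compact_lie_algebra =
  fixes br :: "real^'n \<Rightarrow> real^'n \<Rightarrow> real^'n" and B :: "real^'n \<Rightarrow> real^'n \<Rightarrow> real"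
  assumes bilinear_br: "bilinear br"
    and alternating: "br x x = 0"
    and Jacobi: "br x (br y z) = br (br x y) z + br y (br x z)"
    and inner_B: "inner_form B"
    and skew_B: "B (br x y) z = - B y (br x z)"
    and semisimple: "lie_semisimple br"
begin

lemma linear_ad: "linear (br x)"
  using bilinear_br by (auto simp: bilinear_def)

lemmas br_simps = bilinear_ladd[OF bilinear_br] bilinear_radd[OF bilinear_br]
  bilinear_lmul[OF bilinear_br] bilinear_rmul[OF bilinear_br]
  bilinear_lneg[OF bilinear_br] bilinear_rneg[OF bilinear_br]
  bilinear_lzero[OF bilinear_br] bilinear_rzero[OF bilinear_br]
  bilinear_lsub[OF bilinear_br] bilinear_rsub[OF bilinear_br]

lemma antisym: "br x y = - br y x"
proof -
  have "br (x + y) (x + y) = br x x + br x y + (br y x + br y y)"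
    by (simp only: br_simps add_ac)
  then show ?thesis by (simp add: alternating eq_neg_iff_add_eq_0)
qed

text \<open>Skewness of \<open>br x\<close> absorbs the minus sign in \<open>kip\<close> and leaves
  a sum of squares on the diagonal.\<close>

lemma kip_sum:
  obtains X where "finite X" "\<And>v. v = (\<Sum>b\<in>X. B v b *\<^sub>R b)"
    "\<And>x y. kip br x y = (\<Sum>b\<in>X. B (br x b) (br y b))"
proof -
  interpret inner_form B by (rule inner_B)
  obtain X where X: "finite X" "\<And>v. v = (\<Sum>b\<in>X. B v b *\<^sub>R b)"
    using orthonormal_basis_exists[OF subspace_UNIV] by (metis UNIV_I)
  have "kip br x y = (\<Sum>b\<in>X. B (br x b) (br y b))" for x y
  proof -
    have "linear (\<lambda>z. br x (br y z))"
      using linear_compose[OF linear_ad[of y] linear_ad[of x]] by (simp add: comp_def)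
    then have "kip br x y = - (\<Sum>b\<in>X. B (br x (br y b)) b)"
      unfolding kip_def killing_form_def using trace_matrix_orthonormal[OF inner_B _ X] by simp
    also have "\<dots> = (\<Sum>b\<in>X. B (br x b) (br y b))"
      by (simp add: skew_B sum_negf sym)
    finally show ?thesis .
  qed
  then show ?thesis using that X by blast
qed

text \<open>The centre is an ideal whose derived algebra is already 0, hence a solvable
  ideal.\<close>

lemma center_trivial:
  assumes "\<And>y. br x y = 0" shows "x = 0"
proof -
  define Z where "Z = {x. \<forall>y. br x y = 0}"
  have "lie_ideal br Z"
  proof -
    have "br x y = 0" if "y \<in> Z" for x y using that antisym[of x y] by (simp add: Z_def)
    then show ?thesis by (auto simp: Z_def lie_ideal_def subspace_def br_simps)
  qed
  moreover have "{br x y | x y. x \<in> Z \<and> y \<in> Z} = {0}"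
    by (auto simp: Z_def br_simps intro!: exI[of _ 0])
  then have "((\<lambda>J. bracket_span br J J) ^^ 1) Z = {0}" by (simp add: bracket_span_def)
  then have "lie_solvable br Z" unfolding lie_solvable_def by blast
  ultimately have "Z = {0}" using semisimple by (auto simp: lie_semisimple_def)
  then show ?thesis using assms by (auto simp: Z_def)
qed

text \<open>By \<open>kip_sum\<close> the form is semidefinite, and a null vector brackets every
  basis vector to 0, so it is central.\<close>

lemma inner_kip: "inner_form (kip br)"
proof
  interpret inner_form B by (rule inner_B)
  obtain X where X: "finite X" "\<And>v. v = (\<Sum>b\<in>X. B v b *\<^sub>R b)"
    "\<And>x y. kip br x y = (\<Sum>b\<in>X. B (br x b) (br y b))" using kip_sum by blast
  show "bilinear (kip br)"
    unfolding bilinear_def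
    by (auto intro!: linearI simp: X(3) br_simps q_simps sum.distrib sum_distrib_left)
  show "kip br x y = kip br y x" for x y by (simp add: X(3) sym)
  show "kip br x x > 0" if "x \<noteq> 0" for x
  proof (rule ccontr)
    assume "\<not> kip br x x > 0"
    moreover have "kip br x x \<ge> 0" unfolding X(3) by (intro sum_nonneg nonneg)
    ultimately have "(\<Sum>b\<in>X. B (br x b) (br x b)) = 0" by (simp add: X(3))
    then have 0: "br x b = 0" if "b \<in> X" for b
      using sum_nonneg_eq_0_iff[OF X(1), of "\<lambda>b. B (br x b) (br x b)"] nonneg eq_zero_iff that by auto
    have "br x y = 0" for y
    proof -
      have "br x y = br x (\<Sum>b\<in>X. B y b *\<^sub>R b)" using X(2)[of y] by simp
      also have "\<dots> = 0" by (simp add: linear_sum[OF linear_ad] br_simps 0)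
      finally show ?thesis .
    qed
    then show False using center_trivial that by blast
  qed
qed

sublocale kip: inner_form "kip br" by (rule inner_kip)

text \<open>The Jacobi identity turns \<open>ad [x, y]\<close> into a commutator, and the cyclicity
  of the trace does the rest.\<close>

lemma skew_kip: "kip br (br x y) z = - kip br y (br x z)"
proof -
  let ?T = "\<lambda>f :: real^'n \<Rightarrow> real^'n. trace (matrix f)"
  have lin2: "linear (\<lambda>v. br a (br b v))" for a b
    using linear_compose[OF linear_ad[of b] linear_ad[of a]] by (simp add: comp_def)
  have "br (br x y) v = br x (br y v) - br y (br x v)" for v y using Jacobi[of x y v] by simp
  then have "kip br (br x y) z = ?T (\<lambda>v. br y (br x (br z v))) - ?T (\<lambda>v. br x (br y (br z v)))"
    and "kip br y (br x z) = ?T (\<lambda>v. br y (br z (br x v))) - ?T (\<lambda>v. br y (br x (br z v)))"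
    by (simp_all add: kip_def killing_form_def br_simps trace_matrix_diff)
  moreover have "?T (\<lambda>v. br x (br y (br z v))) = ?T (\<lambda>v. br y (br z (br x v)))"
    using trace_matrix_comp[OF linear_ad lin2, of x y z] by simp
  ultimately show ?thesis by simp
qed

end

section \<open>Roots of a Cartan subalgebra and their reflections\<close>

locale compact_lie_algebra_cartan = compact_lie_algebra br B
  for br :: "real^'n \<Rightarrow> real^'n \<Rightarrow> real^'n" and B :: "real^'n \<Rightarrow> real^'n \<Rightarrow> real" +
  fixes H :: "(real^'n) set"
  assumes cartan: "cartan_subalgebra br H"
begin

lemma subspace_cartan: "subspace H"
  using cartan by (auto simp: cartan_subalgebra_def lie_subalgebra_def)

text \<open>An element that centralises \<open>H\<close> normalises it, and \<open>H\<close> is its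
  own normaliser.\<close>

lemma centralizer_subset: "(\<And>x. x \<in> H \<Longrightarrow> br x w = 0) \<Longrightarrow> w \<in> H"
  using cartan subspace_0[OF subspace_cartan] antisym[of w]
  by (auto simp: cartan_subalgebra_def lie_normalizer_def)

lemma root_vector_nonzero:
  assumes t: "t \<noteq> 0" "t \<in> H" and uv: "(u, v) \<noteq> (0, 0)"
    and eq: "\<And>x. x \<in> H \<Longrightarrow> br x u = - (kip br t x *\<^sub>R v) \<and> br x v = kip br t x *\<^sub>R u"
  shows "u \<noteq> 0"
  using eq[OF t(2)] kip.pos[OF t(1)] uv by (auto simp: br_simps)

text \<open>The reflection is \<open>exp (ad u)\<close> for a multiple \<open>u\<close> of a root vector: since
  \<open>[u, v] = - \<langle>u, u\<rangle> t\<close>, it rotates the plane of \<open>t\<close> and \<open>v\<close>, and a suitable multiple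
  makes the rotation a half turn.\<close>

lemma root_reflection_automorphism:
  assumes "t \<in> roots br H"
  obtains \<sigma> where "linear \<sigma>" "\<And>x y. \<sigma> (br x y) = br (\<sigma> x) (\<sigma> y)"
    "\<And>x y. kip br (\<sigma> x) (\<sigma> y) = kip br x y" "\<And>x. x \<in> H \<Longrightarrow> \<sigma> x = root_reflection br t x"
proof -
  obtain u v where t: "t \<in> H" "t \<noteq> 0" and uv: "(u, v) \<noteq> (0, 0)"
    and eq: "\<And>x. x \<in> H \<Longrightarrow> br x u = - (kip br t x *\<^sub>R v) \<and> br x v = kip br t x *\<^sub>R u"
    using assms unfolding roots_def by blast
  let ?c = "kip br t t" and ?m = "kip br u u"
  have c: "?c > 0" using kip.pos t by blast
  have m: "?m > 0" using kip.pos root_vector_nonzero[OF t(2,1) uv eq] by blast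
  have vv: "kip br v v = ?m"
    using skew_kip[of t u v] eq[OF t(1)] c by (simp add: kip.q_simps)
  have "br u v \<in> H"
  proof (rule centralizer_subset)
    fix x assume "x \<in> H"
    then show "br x (br u v) = 0" using eq Jacobi[of x u v] by (simp add: br_simps alternating)
  qed
  \<comment> \<open>This vector of \<open>H\<close> turns out to be orthogonal to all of
    \<open>H\<close>, in particular to itself, so it is 0.\<close>
  then have d: "br u v + ?m *\<^sub>R t \<in> H" using t subspace_cartan by (intro subspace_add subspace_scale)
  have "kip br (br u v + ?m *\<^sub>R t) x = 0" if "x \<in> H" for x
  proof -
    have "br u x = kip br t x *\<^sub>R v" using eq[OF that] antisym[of u x] by simp
    then have "kip br (br u v) x = - (kip br t x * ?m)" using skew_kip[of u v x] vv by (simp add: kip.q_simps)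
    then show ?thesis by (simp add: kip.q_simps)
  qed
  from this[OF d] have uv_br: "br u v = - (?m *\<^sub>R t)" using kip.eq_zero_iff by (metis add_eq_0_iff2)
  \<comment> \<open>Chosen so that the coefficients \<open>r * ?c\<close> and \<open>r * ?m\<close>
    of \<open>D\<close> on \<open>t\<close> and \<open>v\<close> have product
    \<open>pi\<^sup>2\<close>.\<close>
  define r where "r = pi / sqrt (?m * ?c)"
  define D where "D = br (r *\<^sub>R u)"
  have D_H: "D x = (r * kip br t x) *\<^sub>R v" if "x \<in> H" for x
    using eq[OF that] antisym[of u x] by (simp add: D_def br_simps)
  have linD: "linear D" by (simp add: D_def linear_ad)
  have lin0: "linear (\<lambda>_ :: real. 0 :: real)" by (rule linearI) auto
  have turn: "exp_map D t = - t"
  proof (rule exp_map_half_turn[OF linD])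
    show "D t = (r * ?c) *\<^sub>R v" using D_H t by simp
    show "D v = - ((r * ?m) *\<^sub>R t)" by (simp add: D_def br_simps uv_br)
    show "r * ?c * (r * ?m) = pi\<^sup>2" using c m by (simp add: r_def power2_eq_square field_simps)
  qed
  show ?thesis
  proof (rule that[of "exp_map D"])
    show "linear (exp_map D)" using linear_exp_map linD .
    show "exp_map D (br x y) = br (exp_map D x) (exp_map D y)" for x y
      by (rule exp_map_bilinear[OF bilinear_br linD linD linD]) (unfold D_def, rule Jacobi)
    \<comment> \<open>By skewness the Leibniz sum of \<open>kip\<close> vanishes, so the map on
      \<open>real\<close> is zero and its exponential the identity.\<close>
    show "kip br (exp_map D x) (exp_map D y) = kip br x y" for x y
      using exp_map_bilinear[OF kip.bilin linD linD lin0, of x y] exp_map_zero[OF lin0]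
      by (simp add: D_def skew_kip)
    show "exp_map D x = root_reflection br t x" if x: "x \<in> H" for x
    proof -
      define a where "a = kip br t x / ?c"
      define y where "y = x - a *\<^sub>R t"
      have y: "y \<in> H" "kip br t y = 0"
        using x t subspace_cartan c by (simp_all add: y_def a_def kip.q_simps subspace_diff subspace_scale)
      have "exp_map D (y + a *\<^sub>R t) = y - a *\<^sub>R t"
        using linear_exp_map[OF linD] exp_map_zero[OF linD, of y] D_H[OF y(1)] y
        by (simp add: linear_add linear_scale turn)
      moreover have "y - a *\<^sub>R t = root_reflection br t x"
      proof -
        have "2 * kip br t x / ?c = a + a" by (simp add: a_def)
        then show ?thesis by (simp only: y_def root_reflection_def scaleR_add_left diff_diff_eq)
      qed
      ultimately show ?thesis by (simp add: y_def)
    qed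
  qed
qed

lemma root_reflection_eq: "root_reflection br t = kip.refl t"
  by (simp add: fun_eq_iff root_reflection_def kip.refl_def)

lemma refl_cartan: "t \<in> H \<Longrightarrow> x \<in> H \<Longrightarrow> kip.refl t x \<in> H"
  unfolding kip.refl_def using subspace_cartan by (intro subspace_diff subspace_scale)

text \<open>The automorphism carries root vectors of \<open>s\<close> to root vectors of its image.
  The root equation is needed at all \<open>x\<close> of \<open>H\<close>, and each is
  \<open>\<sigma> y\<close> for the reflected point \<open>y\<close>.\<close>

lemma roots_reflection:
  assumes t: "t \<in> roots br H" and s: "s \<in> roots br H"
  shows "kip.refl t s \<in> roots br H"
proof -
  obtain \<sigma> where \<sigma>: "linear \<sigma>" "\<And>x y. \<sigma> (br x y) = br (\<sigma> x) (\<sigma> y)"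
    "\<And>x y. kip br (\<sigma> x) (\<sigma> y) = kip br x y" "\<And>x. x \<in> H \<Longrightarrow> \<sigma> x = kip.refl t x"
    using root_reflection_automorphism[OF t] by (metis root_reflection_eq)
  have tH: "t \<in> H" using t by (auto simp: roots_def)
  obtain u v where sH: "s \<in> H" "s \<noteq> 0" and uv: "(u, v) \<noteq> (0, 0)"
    and eq: "\<And>x. x \<in> H \<Longrightarrow> br x u = - (kip br s x *\<^sub>R v) \<and> br x v = kip br s x *\<^sub>R u"
    using s unfolding roots_def by blast
  have inj: "\<sigma> x = 0 \<longleftrightarrow> x = 0" for x
    using \<sigma>(3)[of x x] kip.eq_zero_iff linear_0[OF \<sigma>(1)] by metis
  have *: "br x (\<sigma> u) = - (kip br (\<sigma> s) x *\<^sub>R \<sigma> v) \<and> br x (\<sigma> v) = kip br (\<sigma> s) x *\<^sub>R \<sigma> u"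
    if x: "x \<in> H" for x
  proof -
    define y where "y = kip.refl t x"
    have y: "y \<in> H" using refl_cartan tH x by (simp add: y_def)
    have xy: "x = \<sigma> y" using \<sigma>(4)[OF y] by (simp add: y_def kip.refl_refl)
    show ?thesis using eq[OF y] \<sigma>(1) unfolding xy
      by (simp add: \<sigma>(3) linear_neg linear_scale flip: \<sigma>(2))
  qed
  have "\<sigma> s \<in> roots br H"
  proof -
    have "\<sigma> s \<in> H" using \<sigma>(4)[OF sH(1)] refl_cartan[OF tH sH(1)] by simp
    moreover have "\<sigma> s \<noteq> 0" "(\<sigma> u, \<sigma> v) \<noteq> (0, 0)" using inj sH uv by auto
    ultimately show ?thesis
      unfolding roots_def using * by blast
  qed
  then show ?thesis using \<sigma>(4) sH by simp
qed

text \<open>A root \<open>t\<close> has a real vector on which (ad x)^2 acts as - <t, x>^2. These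
  squares are self-adjoint, so vectors for roots other than \<open>t\<close> and \<open>- t\<close>
  are orthogonal to it; orthogonality bounds the number of vectors, and each belongs to at most two
  roots.\<close>

lemma finite_roots: "finite (roots br H)"
proof -
  \<comment> \<open>The condition depends on \<open>t\<close> only through a square, so the choice
    is literally the same for \<open>t\<close> and \<open>- t\<close>.\<close>
  define U where "U t = (SOME u. u \<noteq> 0 \<and> (\<forall>x\<in>H. br x (br x u) = - ((kip br t x)\<^sup>2 *\<^sub>R u)))" for t
  have U: "U t \<noteq> 0 \<and> (\<forall>x\<in>H. br x (br x (U t)) = - ((kip br t x)\<^sup>2 *\<^sub>R U t))" if "t \<in> roots br H" for t
  proof -
    obtain u v where t: "t \<in> H" "t \<noteq> 0" and uv: "(u, v) \<noteq> (0, 0)"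
      and eq: "\<And>x. x \<in> H \<Longrightarrow> br x u = - (kip br t x *\<^sub>R v) \<and> br x v = kip br t x *\<^sub>R u"
      using \<open>t \<in> roots br H\<close> unfolding roots_def by blast
    have "u \<noteq> 0 \<and> (\<forall>x\<in>H. br x (br x u) = - ((kip br t x)\<^sup>2 *\<^sub>R u))"
      using root_vector_nonzero[OF t(2,1) uv eq] eq by (auto simp: br_simps power2_eq_square)
    then show ?thesis unfolding U_def by (rule someI)
  qed
  have orth: "kip br (U s) (U t) = 0"
    if s: "s \<in> roots br H" and t: "t \<in> roots br H" and "s \<noteq> t" "s \<noteq> - t" for s t
  proof -
    define p where "p = s - t"
    define m where "m = s + t"
    have pm: "p \<noteq> 0" "m \<noteq> 0" using \<open>s \<noteq> t\<close> \<open>s \<noteq> - t\<close> by (auto simp: p_def m_def add_eq_0_iff)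
    have pos: "kip br p p > 0" "kip br m m > 0" using pm kip.pos by auto
    have H: "p \<in> H" "m \<in> H" using s t subspace_cartan by (auto simp: p_def m_def roots_def subspace_add subspace_diff)
    \<comment> \<open>The product is <s, x>^2 - <t, x>^2, so such an \<open>x\<close> separates the
      two eigenvalues.\<close>
    obtain x where x: "x \<in> H" "kip br p x * kip br m x \<noteq> 0"
    proof (cases "kip br m p = 0")
      case True
      then show ?thesis using that[of "p + m"] H subspace_cartan pos kip.sym[of p m]
        by (simp add: kip.q_simps subspace_add)
    next
      case False
      then show ?thesis using that[of p] H pos by auto
    qed
    then have ne: "(kip br s x)\<^sup>2 \<noteq> (kip br t x)\<^sup>2"
      by (simp add: p_def m_def kip.q_simps power2_eq_iff add_eq_0_iff2) 
    have "kip br (br x (br x (U s))) (U t) = kip br (U s) (br x (br x (U t)))"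
      using skew_kip by simp
    then have "((kip br s x)\<^sup>2 - (kip br t x)\<^sup>2) * kip br (U s) (U t) = 0"
      using U[OF s] U[OF t] x by (simp add: kip.q_simps algebra_simps)
    then show ?thesis using ne by simp
  qed
  have *: "U (- t) = U t" for t by (simp add: U_def kip.q_simps)
  have "independent (U ` roots br H)"
  proof (intro kip.orthogonal_independent)
    show "0 \<notin> U ` roots br H" using U by force
    fix a b assume "a \<in> U ` roots br H" "b \<in> U ` roots br H" "a \<noteq> b"
    then obtain s t where "s \<in> roots br H" "t \<in> roots br H" "a = U s" "b = U t" "s \<noteq> t" by auto
    with * \<open>a \<noteq> b\<close> show "kip br a b = 0" using orth[of s t] by auto
  qed
  then have fin: "finite (U ` roots br H)" by (rule independent_imp_finite)
  have "finite {s \<in> roots br H. U s = U t}" if t: "t \<in> roots br H" for t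
  proof (rule finite_subset)
    show "{s \<in> roots br H. U s = U t} \<subseteq> {t, - t}"
      using orth[OF _ t] U[OF t] kip.eq_zero_iff by force
  qed simp
  moreover have "roots br H = (\<Union>a\<in>U ` roots br H. {s \<in> roots br H. U s = a})" by auto
  ultimately show ?thesis using finite_UN_I[OF fin, of "\<lambda>a. {s \<in> roots br H. U s = a}"] by fastforce
qed

sublocale finite_reflections "kip br" H "roots br H"
  by unfold_locales
     (auto simp: subspace_cartan finite_roots roots_reflection, auto simp: roots_def)

lemma weyl_group_eq: "weyl_group br H = W"
proof
  show "weyl_group br H \<subseteq> W"
  proof
    fix w assume "w \<in> weyl_group br H"
    then show "w \<in> W"
    proof induction
      case id
      have "kip.word [] \<in> W" unfolding W_def by (rule imageI) simp
      then show ?case by (simp add: id_def)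
    next
      case (reflection t w)
      then obtain ts where ts: "ts \<in> lists (roots br H)" "w = kip.word ts" by (auto simp: W_def)
      have "kip.word (t # ts) \<in> W" unfolding W_def using reflection ts by (intro imageI) auto
      then show ?case by (simp only: root_reflection_eq ts kip.word_simps)
    qed
  qed
  have "kip.word ts \<in> weyl_group br H" if "ts \<in> lists (roots br H)" for ts
    using that
  proof induction
    case (Cons t ts)
    then show ?case using weyl_group.reflection[of t br H "kip.word ts"]
      by (simp only: root_reflection_eq kip.word_simps)
  qed (simp only: kip.word_simps weyl_group.id)
  then show "W \<subseteq> weyl_group br H" by (auto simp: W_def)
qed

end

section \<open>Second derivatives and linear systems\<close>

text \<open>The mean value theorem in direction \<open>v\<close> turns the second difference into a
  difference of values of \<open>f' y v\<close>, and differentiability of that map at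
  \<open>p\<close> alone evaluates it. The quotient is symmetric in \<open>v\<close> and
  \<open>w\<close>, which is its purpose.\<close>

lemma second_difference_quotient:
  fixes f :: "'a::real_normed_vector \<Rightarrow> real"
  assumes "open S" "p \<in> S" and f: "\<And>x. x \<in> S \<Longrightarrow> (f has_derivative f' x) (at x)"
    and G: "((\<lambda>x. f' x v) has_derivative G) (at p)"
  shows "((\<lambda>s. (f (p + s *\<^sub>R v + s *\<^sub>R w) - f (p + s *\<^sub>R v) - f (p + s *\<^sub>R w) + f p) / s\<^sup>2) \<longlongrightarrow> G w) (at_right 0)"
proof (rule tendstoI)
  fix e :: real assume "e > 0"
  define n where "n = norm v + norm w + 1"
  have n: "n > 0" unfolding n_def by (smt (verit) norm_ge_zero)
  \<comment> \<open>Two approximation errors of size \<open>k * (s * n)\<close> then add up to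
    \<open>s * (e / 2)\<close>.\<close>
  define k where "k = e / (4 * n)"
  have k: "k > 0" using \<open>e > 0\<close> n by (simp add: k_def)
  obtain d where d: "d > 0" "\<And>y. norm (y - p) < d \<Longrightarrow> norm (f' y v - f' p v - G (y - p)) \<le> k * norm (y - p)"
    using G k unfolding has_derivative_at_alt by blast
  obtain r where r: "r > 0" "ball p r \<subseteq> S" using assms(1,2) open_contains_ball by blast
  define m where "m = min d r / n"
  have m: "m > 0" using d r n by (simp add: m_def)
  have linG: "linear G" using G has_derivative_linear by blast
  show "\<forall>\<^sub>F s in at_right 0. dist ((f (p + s *\<^sub>R v + s *\<^sub>R w) - f (p + s *\<^sub>R v) - f (p + s *\<^sub>R w) + f p) / s\<^sup>2) (G w) < e"
    unfolding eventually_at_right_field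
  proof (intro exI[of _ m] conjI allI impI m)
    fix s :: real assume s: "0 < s" "s < m"
    have sn: "s * n < d" "s * n < r" using s n by (simp_all add: m_def field_simps)
    have near: "norm (p + (\<tau> * s) *\<^sub>R v + (\<sigma> * s) *\<^sub>R w - p) \<le> s * n"
      if "0 \<le> \<tau>" "\<tau> \<le> 1" "0 \<le> \<sigma>" "\<sigma> \<le> 1" for \<tau> \<sigma>
    proof -
      have "norm (p + (\<tau> * s) *\<^sub>R v + (\<sigma> * s) *\<^sub>R w - p) \<le> norm ((\<tau> * s) *\<^sub>R v) + norm ((\<sigma> * s) *\<^sub>R w)"
        using norm_triangle_ineq[of "(\<tau> * s) *\<^sub>R v" "(\<sigma> * s) *\<^sub>R w"] by (simp add: algebra_simps)
      also have "\<dots> = \<tau> * (s * norm v) + \<sigma> * (s * norm w)" using s that by simp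
      also have "\<dots> \<le> 1 * (s * norm v) + 1 * (s * norm w)"
        using s that by (intro add_mono mult_right_mono) auto
      also have "\<dots> \<le> s * n" using s by (simp add: n_def algebra_simps)
      finally show ?thesis .
    qed
    have inS: "p + (\<tau> * s) *\<^sub>R v + (\<sigma> * s) *\<^sub>R w \<in> S" if "0 \<le> \<tau>" "\<tau> \<le> 1" "0 \<le> \<sigma>" "\<sigma> \<le> 1" for \<tau> \<sigma>
    proof -
      have "p + (\<tau> * s) *\<^sub>R v + (\<sigma> * s) *\<^sub>R w \<in> ball p r"
        using near[OF that] sn unfolding mem_ball dist_norm norm_minus_commute[of p] by linarith
      then show ?thesis using r by blast
    qed
    \<comment> \<open>The factors 1 and 0 are written out so that \<open>near\<close> and
      \<open>inS\<close> match both endpoints.\<close>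
    define \<phi> where "\<phi> \<tau> = f (p + (\<tau> * s) *\<^sub>R v + (1 * s) *\<^sub>R w) - f (p + (\<tau> * s) *\<^sub>R v + (0 * s) *\<^sub>R w)" for \<tau>
    have der: "(\<phi> has_derivative (\<lambda>h. f' (p + (\<tau> * s) *\<^sub>R v + (1 * s) *\<^sub>R w) ((h * s) *\<^sub>R v)
        - f' (p + (\<tau> * s) *\<^sub>R v + (0 * s) *\<^sub>R w) ((h * s) *\<^sub>R v))) (at \<tau> within {0..1})"
      if "\<tau> \<in> {0..1}" for \<tau>
      unfolding \<phi>_def
      by (rule has_derivative_diff;
          rule has_derivative_in_compose2[where t=S, OF has_derivative_at_withinI[OF f]])
         (use inS[of _ 1] inS[of _ 0] that in \<open>auto intro!: derivative_eq_intros\<close>)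
    obtain \<tau> where \<tau>: "\<tau> \<in> {0<..<1}" and eq: "\<phi> 1 - \<phi> 0 = f' (p + (\<tau> * s) *\<^sub>R v + (1 * s) *\<^sub>R w) (((1 - 0) * s) *\<^sub>R v)
        - f' (p + (\<tau> * s) *\<^sub>R v + (0 * s) *\<^sub>R w) (((1 - 0) * s) *\<^sub>R v)"
      using mvt_simple[OF zero_less_one der] unfolding atLeastAtMost_iff by blast
    define y1 where "y1 = p + (\<tau> * s) *\<^sub>R v + (1 * s) *\<^sub>R w"
    define y2 where "y2 = p + (\<tau> * s) *\<^sub>R v + (0 * s) *\<^sub>R w"
    have y: "norm (y1 - p) \<le> s * n" "norm (y2 - p) \<le> s * n" "y1 \<in> S" "y2 \<in> S"
      unfolding y1_def y2_def using \<tau> by (intro near inS; simp)+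
    have lin: "linear (f' y1)" "linear (f' y2)" using f y has_derivative_linear by blast+
    define \<Delta> where "\<Delta> = f (p + s *\<^sub>R v + s *\<^sub>R w) - f (p + s *\<^sub>R v) - f (p + s *\<^sub>R w) + f p"
    have \<Delta>: "\<Delta> = s * (f' y1 v - f' y2 v)"
      using eq lin by (simp add: \<phi>_def \<Delta>_def y1_def[symmetric] y2_def[symmetric] linear_scale[of "f' y1"]
          linear_scale[of "f' y2"] right_diff_distrib flip: scaleR_scaleR)
         (simp add: y1_def y2_def linear_scale right_diff_distrib)
    have "G (y1 - p) - G (y2 - p) = s * G w"
      using linear_diff[OF linG, of "y1 - p" "y2 - p"] linear_scale[OF linG, of s w] by (simp add: y1_def y2_def)
    moreover have "\<bar>f' y1 v - f' p v - G (y1 - p)\<bar> \<le> k * (s * n)" "\<bar>f' y2 v - f' p v - G (y2 - p)\<bar> \<le> k * (s * n)"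
    proof -
      have "\<bar>f' y v - f' p v - G (y - p)\<bar> \<le> k * (s * n)" if y: "norm (y - p) \<le> s * n" for y
      proof -
        have "norm (f' y v - f' p v - G (y - p)) \<le> k * norm (y - p)" using d(2) y sn by simp
        also have "\<dots> \<le> k * (s * n)" using y k by (intro mult_left_mono) auto
        finally show ?thesis by simp
      qed
      then show "\<bar>f' y1 v - f' p v - G (y1 - p)\<bar> \<le> k * (s * n)" "\<bar>f' y2 v - f' p v - G (y2 - p)\<bar> \<le> k * (s * n)"
        using y by blast+
    qed
    ultimately have "\<bar>f' y1 v - f' y2 v - s * G w\<bar> \<le> 2 * (k * (s * n))" by linarith
    moreover have "2 * (k * (s * n)) = s * (e / 2)" using n by (simp add: k_def)
    ultimately have "\<bar>(f' y1 v - f' y2 v) - s * G w\<bar> \<le> s * (e / 2)" by simp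
    moreover have "\<Delta> / s\<^sup>2 - G w = ((f' y1 v - f' y2 v) - s * G w) / s"
      using s by (simp add: \<Delta> power2_eq_square field_simps)
    ultimately have "\<bar>\<Delta> / s\<^sup>2 - G w\<bar> \<le> s * (e / 2) / s"
      using s by (simp only: abs_divide abs_of_pos divide_right_mono less_imp_le)
    then have "\<bar>\<Delta> / s\<^sup>2 - G w\<bar> \<le> e / 2" using s by simp
    then show "dist ((f (p + s *\<^sub>R v + s *\<^sub>R w) - f (p + s *\<^sub>R v) - f (p + s *\<^sub>R w) + f p) / s\<^sup>2) (G w) < e"
      using \<open>e > 0\<close> by (simp add: dist_real_def flip: \<Delta>_def)
  qed
qed

text \<open>Both sides are limits of the same second difference quotient; passing to coordinates
  makes the mean value theorem applicable.\<close>

lemma second_derivative_symmetric: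
  fixes f :: "'a::real_normed_vector \<Rightarrow> 'b::euclidean_space"
  assumes S: "open S" "p \<in> S" and f: "\<And>x. x \<in> S \<Longrightarrow> (f has_derivative f' x) (at x)"
    and G: "((\<lambda>x. f' x v) has_derivative G) (at p)" and H: "((\<lambda>x. f' x w) has_derivative H) (at p)"
  shows "G w = H v"
proof (rule euclidean_eqI)
  fix b :: 'b
  have fb: "((\<lambda>x. f x \<bullet> b) has_derivative (\<lambda>h. f' x h \<bullet> b)) (at x)" if "x \<in> S" for x
    using f[OF that] by (rule has_derivative_inner_left)
  have Gb: "((\<lambda>x. f' x v \<bullet> b) has_derivative (\<lambda>h. G h \<bullet> b)) (at p)"
    "((\<lambda>x. f' x w \<bullet> b) has_derivative (\<lambda>h. H h \<bullet> b)) (at p)"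
    using G H by (auto intro: has_derivative_inner_left)
  have "((\<lambda>s. (f (p + s *\<^sub>R w + s *\<^sub>R v) \<bullet> b - f (p + s *\<^sub>R w) \<bullet> b - f (p + s *\<^sub>R v) \<bullet> b + f p \<bullet> b) / s\<^sup>2)
      \<longlongrightarrow> G w \<bullet> b) (at_right 0)"
    using second_difference_quotient[OF S fb Gb(1), of w] by (simp add: algebra_simps)
  then show "G w \<bullet> b = H v \<bullet> b"
    using second_difference_quotient[OF S fb Gb(2), of v] by (intro tendsto_unique[OF trivial_limit_at_right_real]) auto
qed

section \<open>Differentiable determinants and solutions of linear systems\<close>

lemma differentiable_prod:
  fixes f :: "'i \<Rightarrow> 'a::real_normed_vector \<Rightarrow> real"
  assumes "\<And>i. i \<in> I \<Longrightarrow> f i differentiable (at x)"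
  shows "(\<lambda>x. \<Prod>i\<in>I. f i x) differentiable (at x)"
  using assms by (induction I rule: infinite_finite_induct) auto

lemma differentiable_det:
  fixes M :: "'a::real_normed_vector \<Rightarrow> real^'n^'n"
  assumes "\<And>i j. (\<lambda>a. M a $ i $ j) differentiable (at x)"
  shows "(\<lambda>a. det (M a)) differentiable (at x)"
  unfolding det_def
proof (intro differentiable_sum differentiable_mult differentiable_const ballI)
  fix p :: "'n \<Rightarrow> 'n"
  show "(\<lambda>a. \<Prod>i\<in>UNIV. M a $ i $ p i) differentiable (at x)"
    by (rule differentiable_prod) (rule assms)
qed simp

lemma has_derivative_transform_nhds:
  assumes "(f has_derivative D) (at x)" "\<forall>\<^sub>F y in nhds x. f y = g y"
  shows "(g has_derivative D) (at x)"
proof -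
  have "\<forall>\<^sub>F y in at x. f y = g y" using assms(2) by (auto simp: eventually_at_filter elim: eventually_mono)
  then show ?thesis
    using assms(1) has_derivative_transform_eventually[of f D x UNIV g] eventually_nhds_x_imp_x[OF assms(2)]
    by blast
qed

lemma differentiable_transform_nhds:
  assumes "f differentiable (at x)" "\<forall>\<^sub>F y in nhds x. f y = g y"
  shows "g differentiable (at x)"
  using assms has_derivative_transform_nhds unfolding differentiable_def by blast

lemma has_derivative_Pair_const:
  shows "((\<lambda>b. (a, b)) has_derivative (\<lambda>v. (0, v))) (at x within S)"
    and "((\<lambda>b. (b, a)) has_derivative (\<lambda>v. (v, 0))) (at x within S)"
  using has_derivative_Pair[OF has_derivative_const has_derivative_ident]
    has_derivative_Pair[OF has_derivative_ident has_derivative_const] by blast+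

lemma differentiable_vec:
  fixes f :: "'a::real_normed_vector \<Rightarrow> real^'n"
  assumes "\<And>i. (\<lambda>a. f a $ i) differentiable (at x)"
  shows "f differentiable (at x)"
  using assms differentiable_componentwise_within[of f x UNIV] by (auto simp: Basis_vec_def inner_axis)

text \<open>Cramer's rule reduces the claim to the differentiability of determinants.\<close>

lemma differentiable_linear_system:
  fixes M :: "'a::real_normed_vector \<Rightarrow> real^'n^'n"
  assumes M: "\<And>i j. (\<lambda>a. M a $ i $ j) differentiable (at x)" and L: "L differentiable (at x)"
    and "det (M x) \<noteq> 0" and eq: "\<forall>\<^sub>F a in nhds x. M a *v X a = L a"
  shows "X differentiable (at x)"
proof -
  let ?N = "\<lambda>k a. (\<chi> i j. if j = k then L a $ i else M a $ i $ j) :: real^'n^'n"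
  have L': "(\<lambda>a. L a $ i) differentiable (at x)" for i
    using L bounded_linear.has_derivative[OF bounded_linear_vec_nth] unfolding differentiable_def by blast
  have N: "(\<lambda>a. det (?N k a)) differentiable (at x)" for k
  proof (rule differentiable_det)
    show "(\<lambda>a. ?N k a $ i $ j) differentiable (at x)" for i j
      using M L' by (cases "j = k") simp_all
  qed
  have d: "(\<lambda>a. det (M a)) differentiable (at x)" using M by (rule differentiable_det)
  have "isCont (\<lambda>a. det (M a)) x" using d differentiable_imp_continuous_within by blast
  then have "((\<lambda>a. det (M a)) \<longlongrightarrow> det (M x)) (nhds x)" by (simp add: continuous_within tendsto_nhds_iff)
  then have "\<forall>\<^sub>F a in nhds x. det (M a) \<noteq> 0" by (rule tendsto_imp_eventually_ne) fact
  with eq have "\<forall>\<^sub>F a in nhds x. (\<chi> k. det (?N k a) / det (M a)) = X a"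
    by eventually_elim (simp add: cramer)
  moreover have "(\<lambda>a. (\<chi> k. det (?N k a) / det (M a)) :: real^'n) differentiable (at x)"
    by (rule differentiable_vec) (use N d \<open>det (M x) \<noteq> 0\<close> in \<open>simp add: differentiable_divide\<close>)
  ultimately show ?thesis using differentiable_transform_nhds by blast
qed

lemma smooth_onD:
  assumes "smooth_on S f" "x \<in> S"
  shows "f differentiable (at x)" "(\<lambda>y. frechet_derivative f (at y) v) differentiable (at x)"
proof -
  have "Ck_on (Suc (Suc 0)) S f" using assms by (simp only: smooth_on_def)
  then show "f differentiable (at x)" "(\<lambda>y. frechet_derivative f (at y) v) differentiable (at x)"
    using assms(2) by auto
qed

section \<open>The adjoint representation\<close>

context lie_group
begin

lemma
  assumes "(U, \<phi>) \<in> A"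
  shows chart_openin: "openin T U" and chart_subset: "U \<subseteq> carrier G" and chart_open: "open (\<phi> ` U)"
    and chart_homeo: "homeomorphic_map (subtopology T U) (top_of_set (\<phi> ` U)) \<phi>"
    and chart_inj: "inj_on \<phi> U"
proof -
  show o: "openin T U" and "open (\<phi> ` U)"
    and h: "homeomorphic_map (subtopology T U) (top_of_set (\<phi> ` U)) \<phi>"
    using chart[OF assms] by auto
  show s: "U \<subseteq> carrier G" using openin_subset[OF o] topspace_eq by simp
  show "inj_on \<phi> U"
    using homeomorphic_imp_injective_map[OF h] s by (simp add: topspace_eq Int_absorb1)
qed

lemma chart_image_open:
  assumes "(U, \<phi>) \<in> A" "openin T N"
  shows "open (\<phi> ` (U \<inter> N))"
proof -
  have "open_map (subtopology T U) (top_of_set (\<phi> ` U)) \<phi>"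
    using homeomorphic_imp_open_map chart_homeo[OF assms(1)] by blast
  moreover have "openin (subtopology T U) (U \<inter> N)" using assms(2) by (simp add: openin_subtopology_Int2)
  ultimately have "openin (top_of_set (\<phi> ` U)) (\<phi> ` (U \<inter> N))" by (simp add: open_map_def)
  then show ?thesis using openin_open_trans chart_open[OF assms(1)] by blast
qed

lemma chart_eventually:
  assumes "(U, \<phi>) \<in> A" "openin T N" "g \<in> U" "g \<in> N"
  shows "\<forall>\<^sub>F a in nhds (\<phi> g). a \<in> \<phi> ` U \<and> inv_into U \<phi> a \<in> U \<and> inv_into U \<phi> a \<in> N \<and> \<phi> (inv_into U \<phi> a) = a"
proof -
  have "\<forall>\<^sub>F a in nhds (\<phi> g). a \<in> \<phi> ` (U \<inter> N)"
    using chart_image_open[OF assms(1,2)] assms(3,4) by (intro eventually_nhds_in_open) auto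
  then show ?thesis
    by eventually_elim (use chart_inj[OF assms(1)] in auto)
qed

lemma openin_vimage_mult_left:
  assumes "g \<in> carrier G" "openin T N" shows "openin T {h \<in> carrier G. g \<otimes> h \<in> N}"
proof -
  have "continuous_map T (prod_topology T T) (\<lambda>h. (g, h))"
    using assms(1) by (intro continuous_map_pairedI) (auto simp: topspace_eq)
  from continuous_map_compose[OF this mult_continuous] have "continuous_map T T (\<lambda>h. g \<otimes> h)"
    by (simp add: comp_def)
  from openin_continuous_map_preimage[OF this assms(2)] show ?thesis by (simp add: topspace_eq)
qed

lemma openin_vimage_mult_right:
  assumes "g \<in> carrier G" "openin T N" shows "openin T {h \<in> carrier G. h \<otimes> g \<in> N}"
proof -
  have "continuous_map T (prod_topology T T) (\<lambda>h. (h, g))"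
    using assms(1) by (intro continuous_map_pairedI) (auto simp: topspace_eq)
  from continuous_map_compose[OF this mult_continuous] have "continuous_map T T (\<lambda>h. h \<otimes> g)"
    by (simp add: comp_def)
  from openin_continuous_map_preimage[OF this assms(2)] show ?thesis by (simp add: topspace_eq)
qed

lemma openin_vimage_conj:
  assumes "g \<in> carrier G" "openin T N" shows "openin T {h \<in> carrier G. g \<otimes> h \<otimes> inv g \<in> N}"
proof -
  have "openin T {h \<in> carrier G. g \<otimes> h \<in> {h \<in> carrier G. h \<otimes> inv g \<in> N}}"
    using assms by (intro openin_vimage_mult_left openin_vimage_mult_right) auto
  then show ?thesis by (rule back_subst) (use assms in auto)
qed

lemma chart_at:
  assumes "g \<in> carrier G" obtains U \<phi> where "(U, \<phi>) \<in> A" "g \<in> U"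
proof -
  obtain p where p: "p \<in> A" "g \<in> (case p of (U, \<phi>) \<Rightarrow> U)" using assms cover by blast
  show ?thesis using p that[of "fst p" "snd p"] by (simp add: case_prod_unfold)
qed

text \<open>Symmetry of the second derivative requires first derivatives on a whole neighbourhood,
  which continuity of the multiplication provides.\<close>

lemma mult_open:
  assumes U: "(U, \<phi>) \<in> A"
  shows "open {(\<phi> g, \<phi> h) | g h. g \<in> U \<and> h \<in> U \<and> g \<otimes> h \<in> U}" (is "open ?S")
proof (subst openin_subopen[of euclidean, simplified], safe)
  fix g h assume gh: "g \<in> U" "h \<in> U" "g \<otimes> h \<in> U"
  have "openin (prod_topology T T) {x \<in> topspace (prod_topology T T). (\<lambda>(g, h). g \<otimes> h) x \<in> U}"
    using openin_continuous_map_preimage[OF mult_continuous chart_openin[OF U]] .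
  moreover have "(g, h) \<in> {x \<in> topspace (prod_topology T T). (\<lambda>(g, h). g \<otimes> h) x \<in> U}"
    using gh chart_subset[OF U] by (auto simp: topspace_eq)
  ultimately obtain M N where MN: "openin T M" "openin T N" "g \<in> M" "h \<in> N"
    "M \<times> N \<subseteq> {x \<in> topspace (prod_topology T T). (\<lambda>(g, h). g \<otimes> h) x \<in> U}"
    unfolding openin_prod_topology_alt by meson
  have "open (\<phi> ` (U \<inter> M) \<times> \<phi> ` (U \<inter> N))"
    using chart_image_open[OF U] MN by (intro open_Times) auto
  moreover have "x \<otimes> y \<in> U" if "x \<in> M" "y \<in> N" for x y using that MN(5) by auto
  then have "\<phi> ` (U \<inter> M) \<times> \<phi> ` (U \<inter> N) \<subseteq> ?S" by blast
  moreover have "(\<phi> g, \<phi> h) \<in> \<phi> ` (U \<inter> M) \<times> \<phi> ` (U \<inter> N)" using gh MN by auto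
  ultimately show "\<exists>X. open X \<and> (\<phi> g, \<phi> h) \<in> X \<and> X \<subseteq> ?S" by blast
qed

end

section \<open>Conjugation in coordinates and the adjoint maps\<close>

locale lie_group_chart = lie_group G T A
  for G :: "('g, 'm) monoid_scheme" (structure)
    and T :: "'g topology"
    and A :: "('g set \<times> ('g \<Rightarrow> real ^ 'n)) set" +
  fixes U :: "'g set" and \<phi> :: "'g \<Rightarrow> real ^ 'n"
  assumes U: "(U, \<phi>) \<in> A" and one_U: "\<one> \<in> U"
begin

abbreviation \<iota> :: "real^'n \<Rightarrow> 'g" where "\<iota> \<equiv> inv_into U \<phi>"
abbreviation e :: "real^'n" where "e \<equiv> \<phi> \<one>"

lemma \<iota>_\<phi>: "g \<in> U \<Longrightarrow> \<iota> (\<phi> g) = g"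
  using chart_inj[OF U] by simp

lemma \<iota>_carrier: "a \<in> \<phi> ` U \<Longrightarrow> \<iota> a \<in> carrier G"
  using chart_subset[OF U] inv_into_into[of a \<phi> U] by blast

lemma near_e:
  assumes "openin T N" "\<one> \<in> N"
  shows "\<forall>\<^sub>F a in nhds e. a \<in> \<phi> ` U \<and> \<iota> a \<in> U \<and> \<iota> a \<in> carrier G \<and> \<iota> a \<in> N \<and> \<phi> (\<iota> a) = a"
  using chart_eventually[OF U assms(1) one_U assms(2)]
  by eventually_elim (use chart_subset[OF U] in auto)

definition conj_map :: "'g \<Rightarrow> real^'n \<Rightarrow> real^'n" where
  "conj_map g a = \<phi> (g \<otimes> \<iota> a \<otimes> inv g)"

lemma conj_map_e: "g \<in> carrier G \<Longrightarrow> conj_map g e = e"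
  by (simp add: conj_map_def \<iota>_\<phi> one_U)

lemma near_e_conj:
  assumes "g \<in> carrier G"
  shows "\<forall>\<^sub>F a in nhds e. a \<in> \<phi> ` U \<and> \<iota> a \<in> carrier G \<and> \<phi> (\<iota> a) = a \<and> g \<otimes> \<iota> a \<otimes> inv g \<in> U"
  using near_e[OF openin_vimage_conj[OF assms chart_openin[OF U]]] assms one_U
  by (auto elim: eventually_mono)

text \<open>\<open>g\<close> may lie outside \<open>U\<close>, so conjugation is factored: left
  translation leads from \<open>U\<close> into a chart at \<open>g\<close>, right translation by the
  inverse leads back. Each factor is a partial map of the multiplication in charts.\<close>

lemma conj_map_differentiable:
  assumes g: "g \<in> carrier G"
  shows "conj_map g differentiable (at e)"
proof -
  obtain V \<psi> where V: "(V, \<psi>) \<in> A" "g \<in> V" using chart_at[OF g] .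
  obtain V' \<psi>' where V': "(V', \<psi>') \<in> A" "inv g \<in> V'" using chart_at[of "inv g"] g by auto
  have "(\<lambda>(a, b). \<psi> (inv_into V \<psi> a \<otimes> \<iota> b)) differentiable (at (\<psi> g, e))"
    by (rule smooth_onD(1)[OF mult_smooth[OF V(1) U V(1)]]) (use V one_U g in force)
  moreover have "(\<lambda>a. (\<psi> g, a)) differentiable (at e)"
    unfolding differentiable_def by (auto intro!: derivative_eq_intros exI)
  ultimately have L: "(\<lambda>a. \<psi> (g \<otimes> \<iota> a)) differentiable (at e)"
    using differentiable_chain_at[of "\<lambda>a. (\<psi> g, a)" e "\<lambda>(a, b). \<psi> (inv_into V \<psi> a \<otimes> \<iota> b)"]
      chart_inj[OF V(1)] V(2) by (simp add: comp_def)
  have "(\<lambda>(a, b). \<phi> (inv_into V \<psi> a \<otimes> inv_into V' \<psi>' b)) differentiable (at (\<psi> g, \<psi>' (inv g)))"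
    by (rule smooth_onD(1)[OF mult_smooth[OF V(1) V'(1) U]]) (use V V' one_U g in force)
  moreover have "(\<lambda>a. (a, \<psi>' (inv g))) differentiable (at (\<psi> g))"
    unfolding differentiable_def by (auto intro!: derivative_eq_intros exI)
  ultimately have R: "(\<lambda>b. \<phi> (inv_into V \<psi> b \<otimes> inv g)) differentiable (at (\<psi> (g \<otimes> \<iota> e)))"
    using differentiable_chain_at[of "\<lambda>a. (a, \<psi>' (inv g))" "\<psi> g" "\<lambda>(a, b). \<phi> (inv_into V \<psi> a \<otimes> inv_into V' \<psi>' b)"]
      chart_inj[OF V'(1)] V'(2) g by (simp add: comp_def \<iota>_\<phi> one_U)
  have "\<forall>\<^sub>F a in nhds e. \<iota> a \<in> carrier G \<and> g \<otimes> \<iota> a \<in> V"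
    using near_e[OF openin_vimage_mult_left[OF g chart_openin[OF V(1)]]] g V(2)
    by (auto elim: eventually_mono)
  then have "\<forall>\<^sub>F a in nhds e. ((\<lambda>b. \<phi> (inv_into V \<psi> b \<otimes> inv g)) \<circ> (\<lambda>a. \<psi> (g \<otimes> \<iota> a))) a = conj_map g a"
    by eventually_elim (simp add: conj_map_def chart_inj[OF V(1)])
  then show ?thesis
    using differentiable_transform_nhds[OF differentiable_chain_at[OF L R]] by blast
qed

abbreviation Adj :: "'g \<Rightarrow> real^'n \<Rightarrow> real^'n" where "Adj \<equiv> Ad G U \<phi>"

lemma has_derivative_conj_map: "g \<in> carrier G \<Longrightarrow> (conj_map g has_derivative Adj g) (at e)"
  using conj_map_differentiable frechet_derivative_works[of "conj_map g" "at e"]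
  by (simp add: Ad_def[abs_def] conj_map_def[abs_def])

lemma linear_Ad: "g \<in> carrier G \<Longrightarrow> linear (Adj g)"
  using has_derivative_conj_map has_derivative_linear by blast

lemma Ad_unique:
  assumes "g \<in> carrier G" "(f has_derivative D) (at e)" "\<forall>\<^sub>F a in nhds e. f a = conj_map g a"
  shows "Adj g = D"
proof -
  have "(conj_map g has_derivative D) (at e)"
    using has_derivative_transform_nhds assms(2,3) .
  then show ?thesis using has_derivative_unique has_derivative_conj_map[OF assms(1)] by blast
qed

lemma Ad_one: "Adj \<one> = id"
proof (rule Ad_unique)
  show "\<forall>\<^sub>F a in nhds e. id a = conj_map \<one> a"
    using near_e_conj[OF one_closed] by eventually_elim (simp add: conj_map_def)
  show "(id has_derivative id) (at e)" by (rule has_derivative_id[unfolded id_def[symmetric]])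
qed simp

lemma Ad_mult:
  assumes "g \<in> carrier G" "h \<in> carrier G"
  shows "Adj (g \<otimes> h) = Adj g \<circ> Adj h"
proof (rule Ad_unique)
  show "(conj_map g \<circ> conj_map h has_derivative Adj g \<circ> Adj h) (at e)"
    using has_derivative_conj_map assms by (intro diff_chain_at) (auto simp: conj_map_e)
  show "\<forall>\<^sub>F a in nhds e. (conj_map g \<circ> conj_map h) a = conj_map (g \<otimes> h) a"
    using near_e_conj[OF assms(2)]
  proof eventually_elim
    case (elim a)
    then have "\<iota> (conj_map h a) = h \<otimes> \<iota> a \<otimes> inv h" by (simp add: conj_map_def \<iota>_\<phi>)
    then show ?case using elim assms by (simp add: conj_map_def[of g] conj_map_def[of "g \<otimes> h"] inv_mult_group m_assoc)
  qed
qed (use assms in simp)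

section \<open>Derivatives of the multiplication in coordinates\<close>

definition loc_mult :: "(real^'n) \<times> (real^'n) \<Rightarrow> real^'n" where
  "loc_mult = (\<lambda>(a, b). \<phi> (\<iota> a \<otimes> \<iota> b))"

definition dom :: "((real^'n) \<times> (real^'n)) set" where
  "dom = {(\<phi> g, \<phi> h) | g h. g \<in> U \<and> h \<in> U \<and> g \<otimes> h \<in> U}"

definition dmult :: "(real^'n) \<times> (real^'n) \<Rightarrow> (real^'n) \<times> (real^'n) \<Rightarrow> real^'n" where
  "dmult p v = frechet_derivative loc_mult (at p) v"

definition ddmult :: "(real^'n) \<times> (real^'n) \<Rightarrow> (real^'n) \<times> (real^'n) \<Rightarrow> real^'n" where
  "ddmult v w = frechet_derivative (\<lambda>p. dmult p v) (at (e, e)) w"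

lemma open_dom: "open dom"
  unfolding dom_def using mult_open[OF U] .

lemma dom_left: "a \<in> \<phi> ` U \<Longrightarrow> (a, e) \<in> dom" and dom_right: "a \<in> \<phi> ` U \<Longrightarrow> (e, a) \<in> dom"
  using one_U chart_subset[OF U] unfolding dom_def by force+

lemma e_V: "e \<in> \<phi> ` U"
  using one_U by blast

lemma has_derivative_loc_mult: "p \<in> dom \<Longrightarrow> (loc_mult has_derivative dmult p) (at p)"
  using smooth_onD(1)[OF mult_smooth[OF U U U]] frechet_derivative_works[of loc_mult "at p"]
  by (simp add: dom_def loc_mult_def dmult_def[abs_def])

lemma has_derivative_dmult: "((\<lambda>p. dmult p v) has_derivative ddmult v) (at (e, e))"
  using smooth_onD(2)[OF mult_smooth[OF U U U]] frechet_derivative_works[of "\<lambda>p. dmult p v" "at (e, e)"]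
    dom_left[OF e_V]
  by (simp add: dom_def loc_mult_def dmult_def ddmult_def[abs_def])

lemma ddmult_sym: "ddmult v w = ddmult w v"
  using second_derivative_symmetric[OF open_dom dom_left[OF e_V] has_derivative_loc_mult
      has_derivative_dmult has_derivative_dmult] by blast

lemma has_derivative_mult_left: "a \<in> \<phi> ` U \<Longrightarrow> ((\<lambda>b. loc_mult (a, b)) has_derivative (\<lambda>v. dmult (a, e) (0, v))) (at e)"
  and has_derivative_mult_right: "a \<in> \<phi> ` U \<Longrightarrow> ((\<lambda>b. loc_mult (b, a)) has_derivative (\<lambda>v. dmult (e, a) (v, 0))) (at e)"
  using has_derivative_compose[OF has_derivative_Pair_const(1) has_derivative_loc_mult[OF dom_left]]
    has_derivative_compose[OF has_derivative_Pair_const(2) has_derivative_loc_mult[OF dom_right]]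
  by blast+

text \<open>Left translation by \<open>g\<close> is conjugation by \<open>g\<close> followed by right translation by \<open>g\<close>; differentiating
  at the identity expresses \<open>Ad\<close> through the partial derivatives of the multiplication.\<close>

lemma Ad_dmult:
  assumes a: "a \<in> \<phi> ` U"
  shows "dmult (e, a) (Adj (\<iota> a) v, 0) = dmult (a, e) (0, v)"
proof -
  let ?g = "\<iota> a"
  have g: "?g \<in> carrier G" using \<iota>_carrier a .
  have "((\<lambda>b. loc_mult (b, a)) has_derivative (\<lambda>v. dmult (e, a) (v, 0))) (at (conj_map ?g e))"
    using has_derivative_mult_right[OF a] by (simp add: conj_map_e[OF g])
  from has_derivative_compose[OF has_derivative_conj_map[OF g] this]
  have "((\<lambda>b. loc_mult (conj_map ?g b, a)) has_derivative (\<lambda>v. dmult (e, a) (Adj ?g v, 0))) (at e)" .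
  moreover have "\<forall>\<^sub>F b in nhds e. loc_mult (conj_map ?g b, a) = loc_mult (a, b)"
    using near_e_conj[OF g]
  proof eventually_elim
    case (elim b)
    then have "\<iota> (conj_map ?g b) = ?g \<otimes> \<iota> b \<otimes> inv ?g" by (simp add: conj_map_def \<iota>_\<phi>)
    then show ?case using elim g by (simp add: loc_mult_def m_assoc)
  qed
  ultimately have "((\<lambda>b. loc_mult (a, b)) has_derivative (\<lambda>v. dmult (e, a) (Adj ?g v, 0))) (at e)"
    by (rule has_derivative_transform_nhds)
  from has_derivative_unique[OF this has_derivative_mult_left[OF a]] show ?thesis by (rule fun_cong)
qed

lemma dmult_e: "dmult (e, e) (v, 0) = v" "dmult (e, e) (0, v) = v"
proof -
  have ev: "\<forall>\<^sub>F b in nhds e. b = loc_mult (b, e)" "\<forall>\<^sub>F b in nhds e. b = loc_mult (e, b)"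
    using near_e_conj[OF one_closed]
    by (auto elim!: eventually_mono simp: loc_mult_def \<iota>_\<phi> one_U)
  have id: "((\<lambda>b. b) has_derivative (\<lambda>v. v)) (at e)" by (rule has_derivative_ident)
  have "((\<lambda>b. loc_mult (b, e)) has_derivative (\<lambda>v. v)) (at e)" "((\<lambda>b. loc_mult (e, b)) has_derivative (\<lambda>v. v)) (at e)"
    using has_derivative_transform_nhds[OF id ev(1)] has_derivative_transform_nhds[OF id ev(2)] .
  then show "dmult (e, e) (v, 0) = v" "dmult (e, e) (0, v) = v"
    using has_derivative_unique has_derivative_mult_left[OF e_V] has_derivative_mult_right[OF e_V] by metis+
qed

section \<open>The bracket as an antisymmetrised second derivative\<close>

abbreviation br :: "real^'n \<Rightarrow> real^'n \<Rightarrow> real^'n" where "br \<equiv> lie_bracket G U \<phi>"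

lemma has_derivative_dmult_left:
    "((\<lambda>a. dmult (a, e) v) has_derivative (\<lambda>h. ddmult v (h, 0))) (at e)"
  and has_derivative_dmult_right:
    "((\<lambda>a. dmult (e, a) v) has_derivative (\<lambda>h. ddmult v (0, h))) (at e)"
  using has_derivative_compose[OF has_derivative_Pair_const(2) has_derivative_dmult]
    has_derivative_compose[OF has_derivative_Pair_const(1) has_derivative_dmult] .

lemma vec_expand: "(v :: real^'n) = (\<Sum>j\<in>UNIV. v $ j *\<^sub>R axis j 1)"
  using basis_expansion[of v] by (simp add: scalar_mult_eq_scaleR)

lemma linear_vec_expand: "linear f \<Longrightarrow> f (v :: real^'n) = (\<Sum>j\<in>UNIV. v $ j *\<^sub>R f (axis j 1))"
  by (subst vec_expand) (simp add: linear_sum linear_scale)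

lemma dmult_right_expand:
  assumes "a \<in> \<phi> ` U"
  shows "dmult (e, a) (u, 0) = (\<Sum>j\<in>UNIV. u $ j *\<^sub>R dmult (e, a) (axis j 1, 0))"
proof -
  have "linear (\<lambda>u. dmult (e, a) (u, 0))"
    using has_derivative_linear[OF has_derivative_mult_right[OF assms]] .
  from linear_vec_expand[OF this] show ?thesis .
qed

lemma eventually_V: "\<forall>\<^sub>F a in nhds e. a \<in> \<phi> ` U"
  using near_e_conj[OF one_closed] by (auto elim: eventually_mono)

text \<open>By \<open>Ad_dmult\<close> the value solves a linear system with differentiable
  coefficients whose matrix at \<open>e\<close> is the identity. Without differentiability the
  derivative defining the bracket would say nothing.\<close>

lemma Ad_differentiable: "(\<lambda>a. Adj (\<iota> a) v) differentiable (at e)"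
proof (rule differentiable_linear_system)
  let ?M = "\<lambda>a. (\<chi> i j. dmult (e, a) (axis j 1, 0) $ i) :: real^'n^'n"
  show "(\<lambda>a. ?M a $ i $ j) differentiable (at e)" for i j
    using bounded_linear.has_derivative[OF bounded_linear_vec_nth has_derivative_dmult_right]
    unfolding differentiable_def by auto
  show "(\<lambda>a. dmult (a, e) (0, v)) differentiable (at e)"
    using has_derivative_dmult_left unfolding differentiable_def by blast
  have "?M e = mat 1" by (simp add: dmult_e vec_eq_iff mat_def axis_def)
  then show "det (?M e) \<noteq> 0" by simp
  show "\<forall>\<^sub>F a in nhds e. ?M a *v Adj (\<iota> a) v = dmult (a, e) (0, v)"
    using eventually_V
  proof eventually_elim
    case (elim a)
    have "?M a *v u = dmult (e, a) (u, 0)" for u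
      by (simp add: dmult_right_expand[OF elim, of u] vec_eq_iff matrix_vector_mult_def mult.commute)
    then show ?case using Ad_dmult[OF elim] by simp
  qed
qed

lemma has_derivative_Ad: "((\<lambda>a. Adj (\<iota> a) y) has_derivative (\<lambda>x. br x y)) (at e)"
  using Ad_differentiable[of y] frechet_derivative_works[of "\<lambda>a. Adj (\<iota> a) y" "at e"]
  by (simp add: lie_bracket_def[abs_def])

lemma Ad_e: "Adj (\<iota> e) = id"
  by (simp add: \<iota>_\<phi> one_U Ad_one)

text \<open>Differentiate \<open>Ad_dmult\<close> in \<open>a\<close> by the product rule. The
  varying vector is expanded in the standard basis, so that only the maps
  \<open>dmult (e, a)\<close> at fixed vectors have to be differentiated.\<close>

lemma bracket_eq: "br x y = ddmult (0, y) (x, 0) - ddmult (0, x) (y, 0)"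
proof -
  have "((\<lambda>a. \<Sum>j\<in>UNIV. Adj (\<iota> a) y $ j *\<^sub>R dmult (e, a) (axis j 1, 0)) has_derivative
      (\<lambda>h. \<Sum>j\<in>UNIV. Adj (\<iota> e) y $ j *\<^sub>R ddmult (axis j 1, 0) (0, h) + br h y $ j *\<^sub>R dmult (e, e) (axis j 1, 0))) (at e)"
    by (intro has_derivative_sum has_derivative_scaleR has_derivative_dmult_right
        bounded_linear.has_derivative[OF bounded_linear_vec_nth has_derivative_Ad])
  moreover have "\<forall>\<^sub>F a in nhds e. (\<Sum>j\<in>UNIV. Adj (\<iota> a) y $ j *\<^sub>R dmult (e, a) (axis j 1, 0)) = dmult (a, e) (0, y)"
    using eventually_V by eventually_elim (use Ad_dmult dmult_right_expand in simp)
  ultimately have "((\<lambda>a. dmult (a, e) (0, y)) has_derivative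
      (\<lambda>h. \<Sum>j\<in>UNIV. Adj (\<iota> e) y $ j *\<^sub>R ddmult (axis j 1, 0) (0, h) + br h y $ j *\<^sub>R dmult (e, e) (axis j 1, 0))) (at e)"
    by (rule has_derivative_transform_nhds)
  from has_derivative_unique[OF this has_derivative_dmult_left]
  have "ddmult (0, y) (x, 0) = (\<Sum>j\<in>UNIV. y $ j *\<^sub>R ddmult (axis j 1, 0) (0, x) + br x y $ j *\<^sub>R axis j 1)"
    by (simp add: fun_eq_iff Ad_e dmult_e)
  \<comment> \<open>Symmetry moves the basis vectors to the second argument, in which
    \<open>ddmult\<close> is linear, so the sum can be reassembled.\<close>
  also have "\<dots> = (\<Sum>j\<in>UNIV. y $ j *\<^sub>R ddmult (0, x) (axis j 1, 0)) + br x y"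
    using vec_expand[of "br x y"] by (simp add: sum.distrib ddmult_sym[of "(0, x)"])
  also have "(\<Sum>j\<in>UNIV. y $ j *\<^sub>R ddmult (0, x) (axis j 1, 0)) = ddmult (0, x) (y, 0)"
  proof -
    have "linear (\<lambda>y. ddmult (0, x) (y, 0))"
      using has_derivative_linear[OF has_derivative_dmult_left] .
    from linear_vec_expand[OF this, of y] show ?thesis by simp
  qed
  finally show ?thesis by simp
qed

lemma bracket_antisym: "br x y = - br y x"
  by (simp add: bracket_eq)

lemma bracket_alternating: "br x x = 0"
  by (simp add: bracket_eq)

text \<open>The first argument is the direction of a derivative; the second is handled by
  antisymmetry.\<close>

lemma bilinear_bracket: "bilinear br"
proof -
  have left: "linear (\<lambda>x. br x y)" for y using has_derivative_linear[OF has_derivative_Ad] .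
  have "linear (br x)" for x
  proof -
    have "br x = (\<lambda>y. - br y x)" by (rule ext) (rule bracket_antisym)
    then show ?thesis using linear_compose_neg[OF left[of x]] by argo
  qed
  then show ?thesis using left by (simp add: bilinear_def)
qed

text \<open>Differentiate Ad (g a g^-1) Ad g = Ad g Ad a with respect to \<open>a\<close> at the
  identity.\<close>

lemma Ad_bracket:
  assumes g: "g \<in> carrier G" shows "Adj g (br x y) = br (Adj g x) (Adj g y)"
proof -
  have left: "((\<lambda>a. Adj g (Adj (\<iota> a) y)) has_derivative (\<lambda>x. Adj g (br x y))) (at e)"
    using bounded_linear.has_derivative[OF _ has_derivative_Ad] linear_Ad[OF g] linear_conv_bounded_linear by blast
  have "((\<lambda>a. Adj (\<iota> a) (Adj g y)) has_derivative (\<lambda>x. br x (Adj g y))) (at (conj_map g e))"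
    using has_derivative_Ad by (simp add: conj_map_e[OF g])
  from has_derivative_compose[OF has_derivative_conj_map[OF g] this]
  have "((\<lambda>a. Adj (\<iota> (conj_map g a)) (Adj g y)) has_derivative (\<lambda>x. br (Adj g x) (Adj g y))) (at e)" .
  moreover have "\<forall>\<^sub>F a in nhds e. Adj (\<iota> (conj_map g a)) (Adj g y) = Adj g (Adj (\<iota> a) y)"
    using near_e_conj[OF g]
  proof eventually_elim
    case (elim a)
    have "Adj (\<iota> (conj_map g a)) \<circ> Adj g = Adj (g \<otimes> \<iota> a \<otimes> inv g \<otimes> g)"
      using elim g by (subst Ad_mult) (auto simp: conj_map_def \<iota>_\<phi>)
    also have "g \<otimes> \<iota> a \<otimes> inv g \<otimes> g = g \<otimes> \<iota> a" using elim g by (simp add: m_assoc)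
    also have "Adj \<dots> = Adj g \<circ> Adj (\<iota> a)" using elim g Ad_mult by blast
    finally show ?case by (simp add: fun_eq_iff)
  qed
  ultimately have "((\<lambda>a. Adj g (Adj (\<iota> a) y)) has_derivative (\<lambda>x. br (Adj g x) (Adj g y))) (at e)"
    by (rule has_derivative_transform_nhds)
  from fun_cong[OF has_derivative_unique[OF left this]] show ?thesis .
qed

lemma has_derivative_bilinear_Ad:
  assumes "bilinear P"
  shows "((\<lambda>a. P (Adj (\<iota> a) x) (Adj (\<iota> a) y)) has_derivative (\<lambda>z. P x (br z y) + P (br z x) y)) (at e)"
proof -
  have "bounded_bilinear P" using assms by (simp add: bilinear_conv_bounded_bilinear)
  from bounded_bilinear.FDERIV[OF this has_derivative_Ad has_derivative_Ad, of x y] show ?thesis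
    by (simp add: Ad_e)
qed

text \<open>The derivative at the identity of the fact that every \<open>Adj g\<close> respects the
  bracket.\<close>

lemma bracket_Jacobi: "br z (br x y) = br (br z x) y + br x (br z y)"
proof -
  have "\<forall>\<^sub>F a in nhds e. br (Adj (\<iota> a) x) (Adj (\<iota> a) y) = Adj (\<iota> a) (br x y)"
    using eventually_V by eventually_elim (simp add: Ad_bracket \<iota>_carrier)
  from has_derivative_transform_nhds[OF has_derivative_bilinear_Ad[OF bilinear_bracket] this]
  have "((\<lambda>a. Adj (\<iota> a) (br x y)) has_derivative (\<lambda>z. br x (br z y) + br (br z x) y)) (at e)" .
  from fun_cong[OF has_derivative_unique[OF this has_derivative_Ad], of z] show ?thesis by (simp add: add.commute)
qed

lemma bracket_skew:
  assumes P: "bilinear P" and inv: "\<And>g x y. g \<in> carrier G \<Longrightarrow> P (Adj g x) (Adj g y) = (P x y :: real)"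
  shows "P (br z x) y = - P x (br z y)"
proof -
  have "\<forall>\<^sub>F a in nhds e. P (Adj (\<iota> a) x) (Adj (\<iota> a) y) = P x y"
    using eventually_V by eventually_elim (simp add: inv \<iota>_carrier)
  from has_derivative_transform_nhds[OF has_derivative_bilinear_Ad[OF P] this]
  have "((\<lambda>a. P x y) has_derivative (\<lambda>z. P x (br z y) + P (br z x) y)) (at e)" .
  from fun_cong[OF has_derivative_unique[OF this has_derivative_const], of z] show ?thesis by simp
qed

lemma Ad_bounded_near_one:
  obtains N C where "openin T N" "\<one> \<in> N" "\<And>g v. g \<in> N \<Longrightarrow> g \<in> carrier G \<and> norm (Adj g v) \<le> C * norm v"
proof -
  \<comment> \<open>At \<open>e\<close> the map is the identity and the basis vector has norm 1, so
    2 leaves room nearby.\<close>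
  have "\<forall>\<^sub>F a in nhds e. norm (Adj (\<iota> a) (axis j 1)) < 2" for j
  proof -
    have "isCont (\<lambda>a. Adj (\<iota> a) (axis j 1)) e" using Ad_differentiable differentiable_imp_continuous_within by blast
    then have "((\<lambda>a. norm (Adj (\<iota> a) (axis j 1))) \<longlongrightarrow> norm (Adj (\<iota> e) (axis j 1))) (nhds e)"
      by (intro tendsto_norm) (simp add: continuous_within tendsto_nhds_iff)
    then show ?thesis by (rule order_tendstoD) (simp add: Ad_e)
  qed
  then have "\<forall>\<^sub>F a in nhds e. \<forall>j. norm (Adj (\<iota> a) (axis j 1)) < 2"
    by (rule eventually_all_finite)
  then obtain S where S: "open S" "e \<in> S" "\<And>a j. a \<in> S \<Longrightarrow> norm (Adj (\<iota> a) (axis j 1)) < 2"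
    unfolding eventually_nhds by blast
  define N where "N = {g \<in> U. \<phi> g \<in> S}"
  have "continuous_map (subtopology T U) (top_of_set (\<phi> ` U)) \<phi>"
    using homeomorphic_imp_continuous_map[OF chart_homeo[OF U]] .
  then have "continuous_map (subtopology T U) euclidean \<phi>" using continuous_map_into_fulltopology by blast
  from openin_continuous_map_preimage[OF this, of S] have "openin (subtopology T U) N"
    using S(1) chart_subset[OF U] by (simp add: N_def topspace_eq Int_absorb1)
  then have "openin T N" using openin_trans_full chart_openin[OF U] by blast
  moreover have "\<one> \<in> N" using one_U S by (simp add: N_def)
  moreover have "g \<in> carrier G \<and> norm (Adj g v) \<le> (2 * real CARD('n)) * norm v" if g: "g \<in> N" for g v
  proof
    show gc: "g \<in> carrier G" using g chart_subset[OF U] by (auto simp: N_def)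
    have "norm (Adj g v) \<le> (\<Sum>j\<in>UNIV. norm (v $ j *\<^sub>R Adj g (axis j 1)))"
      using linear_vec_expand[OF linear_Ad[OF gc], of v] norm_sum by metis
    also have "\<dots> \<le> (\<Sum>j\<in>(UNIV :: 'n set). norm v * 2)"
    proof (rule sum_mono)
      fix j
      have "norm (Adj g (axis j 1)) \<le> 2" using S(3)[of "\<phi> g" j] g by (simp add: N_def \<iota>_\<phi>)
      then show "norm (v $ j *\<^sub>R Adj g (axis j 1)) \<le> norm v * 2"
        using component_le_norm_cart[of v j] by (auto intro!: mult_mono)
    qed
    finally show "norm (Adj g v) \<le> (2 * real CARD('n)) * norm v" by simp
  qed
  ultimately show ?thesis using that by blast
qed

text \<open>The local bound at the identity is spread by translation: finitely many translates of
  \<open>N\<close> cover the group, and on the translate by \<open>i\<close> one has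
  \<open>Adj g = Adj i \<circ> Adj (inv i \<otimes> g)\<close>.\<close>

lemma Ad_bounded:
  assumes "compact_space T"
  obtains M where "\<And>g v. g \<in> carrier G \<Longrightarrow> norm (Adj g v) \<le> M * norm v"
proof -
  obtain N C where N: "openin T N" "\<one> \<in> N" "\<And>g v. g \<in> N \<Longrightarrow> g \<in> carrier G \<and> norm (Adj g v) \<le> C * norm v"
    using Ad_bounded_near_one by metis
  define N' where "N' g = {h \<in> carrier G. inv g \<otimes> h \<in> N}" for g
  have "openin T (N' g)" if "g \<in> carrier G" for g
    unfolding N'_def using that N by (intro openin_vimage_mult_left) auto
  then have "Ball (N' ` carrier G) (openin T)" by blast
  moreover have "g \<in> N' g" if "g \<in> carrier G" for g using that N by (simp add: N'_def)
  then have "topspace T \<subseteq> \<Union> (N' ` carrier G)" unfolding topspace_eq by blast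
  ultimately obtain \<F> where \<F>: "finite \<F>" "\<F> \<subseteq> N' ` carrier G" "carrier G \<subseteq> \<Union>\<F>"
    using assms unfolding compact_space_def compactin_def topspace_eq by meson
  then obtain I where I: "I \<subseteq> carrier G" "finite I" "\<F> = N' ` I"
    using finite_subset_image by metis
  have "\<exists>B. B > 0 \<and> (\<forall>v. norm (Adj g v) \<le> B * norm v)" if "g \<in> I" for g
    using linear_bounded_pos[OF linear_Ad] I that by blast
  then obtain B where B: "\<And>g. g \<in> I \<Longrightarrow> B g > 0" "\<And>g v. g \<in> I \<Longrightarrow> norm (Adj g v) \<le> B g * norm v" by metis
  have "norm (Adj g v) \<le> ((\<Sum>i\<in>I. B i) * \<bar>C\<bar>) * norm v" if g: "g \<in> carrier G" for g v
  proof -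
    obtain i where i: "i \<in> I" "g \<in> N' i" using \<F>(3) I(3) g by auto
    then have ic: "i \<in> carrier G" "inv i \<otimes> g \<in> N" using I by (auto simp: N'_def)
    have "Adj g = Adj i \<circ> Adj (inv i \<otimes> g)" using ic g by (subst Ad_mult[symmetric]) (auto simp: m_assoc[symmetric])
    then have "norm (Adj g v) \<le> B i * norm (Adj (inv i \<otimes> g) v)" using B i by simp
    also have "\<dots> \<le> (\<Sum>i\<in>I. B i) * (\<bar>C\<bar> * norm v)"
    proof (rule mult_mono)
      show "B i \<le> (\<Sum>i\<in>I. B i)" using i I B by (intro member_le_sum) (auto simp: less_imp_le)
      have "norm (Adj (inv i \<otimes> g) v) \<le> C * norm v" using N ic by blast
      also have "\<dots> \<le> \<bar>C\<bar> * norm v" by (intro mult_right_mono) auto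
      finally show "norm (Adj (inv i \<otimes> g) v) \<le> \<bar>C\<bar> * norm v" .
      show "(\<Sum>i\<in>I. B i) \<ge> 0" using B by (intro sum_nonneg) (auto simp: less_imp_le)
    qed simp
    finally show ?thesis by (simp add: mult.assoc)
  qed
  then show ?thesis using that by blast
qed

end

section \<open>The Hofer norm polytope\<close>

theorem theorem6p21:
  fixes K :: "('g, 'm) monoid_scheme"
    and T :: "'g topology"
    and A :: "('g set \<times> ('g \<Rightarrow> real ^ 'n)) set"
    and U :: "'g set" and \<phi> :: "'g \<Rightarrow> real ^ 'n"
    and br :: "real ^ 'n \<Rightarrow> real ^ 'n \<Rightarrow> real ^ 'n"
    and \<hh> Hp E :: "(real ^ 'n) set"
    and W :: "(real ^ 'n \<Rightarrow> real ^ 'n) set" and wstar :: "real ^ 'n \<Rightarrow> real ^ 'n"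
    and x :: "nat \<Rightarrow> real ^ 'n" and n i :: nat
  assumes "lie_group K T A" and "compact_space T" and "connected_space T"
    and "(U, \<phi>) \<in> A" and "\<one>\<^bsub>K\<^esub> \<in> U"
    and br_def: "br = lie_bracket K U \<phi>"
    and "lie_semisimple br"
    and "cartan_subalgebra br \<hh>"
    and "closed_weyl_chamber br \<hh> Hp"
    and W_def: "W = weyl_group br \<hh>"
    and "wstar \<in> W" and "wstar ` Hp = uminus ` Hp"
    and Ad_invariant: "\<And>g e. g \<in> carrier K \<Longrightarrow> e \<in> E \<Longrightarrow> Ad K U \<phi> g e \<in> E"
    and "E \<inter> Hp = convex hull (x ` {1..n})"
    and "i \<in> {1..n}"
    and regular: "regular_point br \<hh> (x i - wstar (x i))"
    and dominant: "\<And>z j. z \<in> Hp \<Longrightarrow> j \<in> {1..n} \<Longrightarrow> kip br z (x i) \<ge> kip br z (x j)"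
  shows "\<exists>y. regular_point br \<hh> y \<and>
    {p. p extreme_point_of (hofer_polytope W (x ` {1..n}))} = (\<lambda>w. w y) ` W"
proof -
  interpret chart: lie_group_chart K T A U \<phi>
    using assms(1,4,5) by (simp add: lie_group_chart_def lie_group_chart_axioms_def)
  obtain M where M: "\<And>g v. g \<in> carrier K \<Longrightarrow> norm (Ad K U \<phi> g v) \<le> M * norm v"
    using chart.Ad_bounded[OF \<open>compact_space T\<close>] by blast
  have matrix_Ad: "matrix (Ad K U \<phi> g) *v v = Ad K U \<phi> g v" if "g \<in> carrier K" for g v
    using chart.linear_Ad[OF that] by (simp add: matrix_works)
  have matrix_mult: "matrix (Ad K U \<phi> g) ** matrix (Ad K U \<phi> h) = matrix (Ad K U \<phi> (g \<otimes>\<^bsub>K\<^esub> h))"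
    if "g \<in> carrier K" "h \<in> carrier K" for g h
    using chart.linear_Ad that by (simp add: chart.Ad_mult matrix_compose)
  have matrix_one: "matrix (Ad K U \<phi> \<one>\<^bsub>K\<^esub>) = mat 1"
    by (simp add: chart.Ad_one matrix_id_mat_1)
  obtain B where B: "inner_form B"
    and B_inv: "\<And>N x y. N \<in> (\<lambda>g. matrix (Ad K U \<phi> g)) ` carrier K \<Longrightarrow> B (N *v x) (N *v y) = B x y"
  proof (rule invariant_inner_form_exists)
    \<comment> \<open>Saved under a name because \<open>that\<close> is rebound by the premises of
      the goals below.\<close>
    note B_ex = that
    show "mat 1 \<in> (\<lambda>g. matrix (Ad K U \<phi> g)) ` carrier K"
      using matrix_one chart.one_closed by (metis imageI)
    show "N ** N' \<in> (\<lambda>g. matrix (Ad K U \<phi> g)) ` carrier K"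
      if "N \<in> (\<lambda>g. matrix (Ad K U \<phi> g)) ` carrier K" "N' \<in> (\<lambda>g. matrix (Ad K U \<phi> g)) ` carrier K" for N N'
      using that matrix_mult by auto
    show "\<exists>N'\<in>(\<lambda>g. matrix (Ad K U \<phi> g)) ` carrier K. N ** N' = mat 1"
      if N: "N \<in> (\<lambda>g. matrix (Ad K U \<phi> g)) ` carrier K" for N
    proof -
      obtain g where g: "g \<in> carrier K" "N = matrix (Ad K U \<phi> g)" using N by blast
      then have "N ** matrix (Ad K U \<phi> (inv\<^bsub>K\<^esub> g)) = mat 1" by (simp add: matrix_mult matrix_one)
      then show ?thesis using g chart.inv_closed by blast
    qed
    show "norm (N *v v) \<le> M * norm v" if "N \<in> (\<lambda>g. matrix (Ad K U \<phi> g)) ` carrier K" for N v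
      using that M matrix_Ad by auto
    show thesis if "inner_form B'"
      and "\<And>N x y. N \<in> (\<lambda>g. matrix (Ad K U \<phi> g)) ` carrier K \<Longrightarrow> B' (N *v x) (N *v y) = B' x y" for B'
      using B_ex[OF that] .
  qed
  have B_Ad: "B (Ad K U \<phi> g y) (Ad K U \<phi> g z) = B y z" if "g \<in> carrier K" for g y z
    using B_inv[of "matrix (Ad K U \<phi> g)" y z] that matrix_Ad by simp
  interpret compact_lie_algebra_cartan br B \<hh>
  proof unfold_locales
    show "bilinear br" unfolding br_def by (rule chart.bilinear_bracket)
    show "br x x = 0" for x unfolding br_def by (rule chart.bracket_alternating)
    show "br x (br y z) = br (br x y) z + br y (br x z)" for x y z
      unfolding br_def by (rule chart.bracket_Jacobi)
    show "B (br x y) z = - B y (br x z)" for x y z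
      unfolding br_def by (rule chart.bracket_skew[OF inner_form.bilin[OF B] B_Ad])
  qed (rule inner_form.bilin[OF B] inner_form.sym[OF B] inner_form.pos[OF B] assms(7,8) | assumption)+
  have W_eq: "W = finite_reflections.W (kip br) (roots br \<hh>)"
    using \<open>W = weyl_group br \<hh>\<close> weyl_group_eq by simp
  obtain C where C: "C \<in> components {x \<in> \<hh>. \<forall>t\<in>roots br \<hh>. kip br t x \<noteq> 0}" "Hp = closure C"
    using \<open>closed_weyl_chamber br \<hh> Hp\<close> unfolding closed_weyl_chamber_def by blast
  obtain c where c: "\<And>t. t \<in> roots br \<hh> \<Longrightarrow> kip br t c \<noteq> 0" "closure C = chamber c"
    using closure_component[OF C(1)] by blast
  have Hp: "Hp = chamber c" using C c by simp
  \<comment> \<open>Each \<open>x j\<close> is dominant because it lies in the hull, which is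
    contained in \<open>Hp\<close>.\<close>
  have X: "x ` {1..n} \<subseteq> chamber c"
    using \<open>E \<inter> Hp = convex hull (x ` {1..n})\<close> hull_subset[of "x ` {1..n}" convex] unfolding Hp by blast
  have "{p. p extreme_point_of (hofer_polytope W (x ` {1..n}))} = (\<lambda>w. w (x i - wstar (x i))) ` W"
    unfolding W_eq
  proof (rule extreme_points_orbit_polytope[OF c(1)])
    show "wstar \<in> finite_reflections.W (kip br) (roots br \<hh>)" using \<open>wstar \<in> W\<close> by (simp only: W_eq)
    show "wstar ` chamber c = uminus ` chamber c" using \<open>wstar ` Hp = uminus ` Hp\<close> by (simp add: Hp)
    show "kip br z y \<le> kip br z (x i)" if "z \<in> chamber c" "y \<in> x ` {1..n}" for z y
      using that dominant by (auto simp: Hp)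
  qed (use X \<open>i \<in> {1..n}\<close> in auto)
  then show ?thesis using regular by blast
qed

end
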